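(* Let $\hat G$, $Y$, $\mathcal{Y}(Y)$, $\Xi(\hat G)$, $\Xi(\hat G,\mathcal{Y}(Y))$ and $\|\cdot\|_{\mathcal{Y},\Xi}$ be as in the context. Suppose that: (i) there is $K_\Xi>0$ such that for all $\hat u_1,\hat u_2\in C^\infty_c(\hat G)'$, $\hat u_1\ge0$ and $\hat u_2-\hat u_1\ge0$ imply $\|\hat u_1\|_\Xi\le K_\Xi\|\hat u_2\|_\Xi$ (so that $\|\cdot\|_{\mathcal{Y},\Xi}$ is a quasi-norm); (ii) the embedding $\Xi(\hat G)\hookrightarrow L^0(\hat G)$ is continuous; (iii) there is $c_\Xi>0$ such that $\|\hat u\|_\Xi\le c_\Xi\||\hat u|\|_\Xi$ for all $\hat u\in L^1_{\mathrm{loc}}(\hat G)$. If $\{\hat u_m\}_{m=1}^\infty\subset\Xi(\hat G,\mathcal{Y}(Y))$ is a Cauchy sequence (i.e. for every $\epsilon>0$, $\|\hat u_m-\hat u_k\|_{\mathcal{Y},\Xi}<\epsilon$ for all sufficiently large $m,k$), then there exists $\hat u\in\Xi(\hat G,\mathcal{Y}(Y))$ such that $\hat u_m\to\hat u$ in measure as $m\to\infty$.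
   Context: $G=\prod_{i=1}^nG_i$ with $G_i\in\{\mathbb{R},\mathbb{T},\mathbb{Z}\}$, $\mathbb{T}=\mathbb{R}/\mathbb{Z}$; $\hat G=\prod_i\hat G_i$ with $\hat{\mathbb{R}}=\mathbb{R}$, $\hat{\mathbb{T}}=\mathbb{Z}$, $\hat{\mathbb{Z}}=\mathbb{T}$, with Haar measure $d\xi$ (product of Lebesgue/counting measures). $\mathcal{S}(\hat G)$ is the Schwartz–Bruhat space and primes denote continuous duals. $Y$ is a connected smooth manifold without boundary. Locally integrable functions on $\hat G$ are identified with distributions by integration against $d\xi$; $\hat u\ge0$ for a distribution means $\hat u(\hat f)\ge0$ for all test functions $\hat f\ge0$. $\mathcal{Y}(Y)$ is a Banach space continuously embedded in $C^\infty_c(Y)'$. $\Xi(\hat G)$ is a Banach space continuously embedded in $\mathcal{S}(\hat G)'$ with $\Xi(\hat G)\subset L^1_{\mathrm{loc}}(\hat G)\cap\mathcal{S}(\hat G)'$; its norm is regarded as a $[0,+\infty]$-valued extended norm on $C^\infty_c(\hat G)'$ (set to $+\infty$ wherever undefined). $L^1_{\mathrm{loc}}(\hat G,\mathcal{Y}(Y))$ is the space of locally Bochner-integrable functions $\hat G\to\mathcal{Y}(Y)$; $$\Xi(\hat G,\mathcal{Y}(Y))=\{\hat u\in L^1_{\mathrm{loc}}(\hat G,\mathcal{Y}(Y)):\ \|\hat u(\cdot)\|_\mathcal{Y}\in\Xi(\hat G)\},\quad\|\hat u\|_{\mathcal{Y},\Xi}=\big\|\|\hat u(\cdot)\|_\mathcal{Y}\big\|_\Xi\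 \ (\hat u\in L^1_{\mathrm{loc}}(\hat G,\mathcal{Y}(Y))).$$ $L^0(\hat G)$ is the space of (classes of) measurable functions with the topology of convergence in measure. Convergence $\hat u_m\to\hat u$ in measure for $\mathcal{Y}(Y)$-valued functions means that $\|\hat u_m(\cdot)-\hat u(\cdot)\|_\mathcal{Y}\to0$ in measure on $\hat G$. *)

theory Defs
  imports "HOL-Analysis.Analysis"
begin

section \<open>Complex Banach spaces\<close>

class complex_banach = banach +
  fixes scaleC :: "complex \<Rightarrow> 'a \<Rightarrow> 'a"
  assumes scaleC_add_right: "scaleC c (x + y) = scaleC c x + scaleC c y"
    and scaleC_add_left: "scaleC (b + c) x = scaleC b x + scaleC c x"
    and scaleC_scaleC: "scaleC b (scaleC c x) = scaleC (b * c) x"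
    and scaleC_of_real: "scaleC (complex_of_real r) x = r *\<^sub>R x"
    and norm_scaleC: "norm (scaleC c x) = cmod c * norm x"

instantiation complex :: complex_banach
begin
definition scaleC_complex :: "complex \<Rightarrow> complex \<Rightarrow> complex" where "scaleC_complex c x = c * x"
instance
  by standard (auto simp: scaleC_complex_def algebra_simps norm_mult scaleR_conv_of_real)
end

text \<open>Functionals are total functions of which only the values on a space \<open>T\<close> of test functions
  matter. An embedding into the dual of \<open>T\<close> is continuous for the weak-* topology; since the test
  function spaces below are barrelled, this is the same as continuity for the strong topology.\<close>

definition linear_functional_on :: "('a \<Rightarrow> complex) set \<Rightarrow> (('a \<Rightarrow> complex) \<Rightarrow> complex) \<Rightarrow> bool" where
  "linear_functional_on T u \<longleftrightarrow>
     (\<forall>f\<in>T. \<forall>g\<in>T. u (\<lambda>x. f x + g x) = u f + u g) \<and> (\<forall>c. \<forall>f\<in>T. u (\<lambda>x. c * f x) = c * u f)"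

definition continuously_embedded ::
  "('a \<Rightarrow> complex) set \<Rightarrow> (('a \<Rightarrow> complex) \<Rightarrow> complex) set
     \<Rightarrow> ('x::complex_banach \<Rightarrow> ('a \<Rightarrow> complex) \<Rightarrow> complex) \<Rightarrow> bool" where
  "continuously_embedded T D \<iota> \<longleftrightarrow>
     range \<iota> \<subseteq> D \<and>
     (\<forall>f\<in>T. \<forall>x y. \<iota> (x + y) f = \<iota> x f + \<iota> y f) \<and>
     (\<forall>f\<in>T. \<forall>c x. \<iota> (scaleC c x) f = c * \<iota> x f) \<and>
     (\<forall>x y. (\<forall>f\<in>T. \<iota> x f = \<iota> y f) \<longrightarrow> x = y) \<and>
     (\<forall>f\<in>T. continuous_on UNIV (\<lambda>x. \<iota> x f))"


section \<open>Partial derivatives\<close>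

definition partial1 :: "'i \<Rightarrow> (('i \<Rightarrow> real) \<Rightarrow> complex) \<Rightarrow> ('i \<Rightarrow> real) \<Rightarrow> complex" where
  "partial1 i f x = vector_derivative (\<lambda>t. f (x(i := t))) (at (x i))"

definition partials :: "'i list \<Rightarrow> (('i \<Rightarrow> real) \<Rightarrow> complex) \<Rightarrow> ('i \<Rightarrow> real) \<Rightarrow> complex" where
  "partials is f = foldr partial1 is f"

text \<open>Smoothness on \<open>S\<close> in the coordinates \<open>I\<close>; it is only used for \<open>S\<close> that contain,
  with every point \<open>x\<close> and every \<open>i \<in> I\<close>, the points \<open>x(i := t)\<close> with \<open>t\<close> close to \<open>x i\<close>.\<close>

definition smooth_along :: "'i set \<Rightarrow> ('i \<Rightarrow> real) set \<Rightarrow> (('i \<Rightarrow> real) \<Rightarrow> complex) \<Rightarrow> bool" where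
  "smooth_along I S f \<longleftrightarrow>
     (\<forall>is. set is \<subseteq> I \<longrightarrow>
        continuous_on S (partials is f) \<and>
        (\<forall>i\<in>I. \<forall>x\<in>S. (\<lambda>t. partials is f (x(i := t))) differentiable at (x i)))"

definition tsupport :: "'a topology \<Rightarrow> ('a \<Rightarrow> complex) \<Rightarrow> 'a set" where
  "tsupport X f = X closure_of {x \<in> topspace X. f x \<noteq> 0}"


section \<open>Distributions on smooth manifolds\<close>

text \<open>A manifold of dimension \<open>d\<close> (possibly 0) is given with a smooth atlas of charts
  \<open>(U, \<phi>)\<close> onto open subsets of \<^const>\<open>Euclidean_space\<close> \<open>d\<close>.\<close>

definition smooth_manifold ::
  "'m topology \<Rightarrow> nat \<Rightarrow> ('m set \<times> ('m \<Rightarrow> nat \<Rightarrow> real)) set \<Rightarrow> bool" where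
  "smooth_manifold Y d \<A> \<longleftrightarrow>
     Hausdorff_space Y \<and> second_countable Y \<and>
     (\<Union>(U, \<phi>)\<in>\<A>. U) = topspace Y \<and>
     (\<forall>(U, \<phi>)\<in>\<A>. openin Y U \<and> openin (Euclidean_space d) (\<phi> ` U) \<and>
        homeomorphic_map (subtopology Y U) (subtopology (Euclidean_space d) (\<phi> ` U)) \<phi>) \<and>
     (\<forall>(U, \<phi>)\<in>\<A>. \<forall>(V, \<psi>)\<in>\<A>. \<forall>j<d.
        smooth_along {..<d} (\<phi> ` (U \<inter> V)) (\<lambda>x. complex_of_real (\<psi> (inv_into U \<phi> x) j)))"

definition mfd_test_functions ::
  "'m topology \<Rightarrow> nat \<Rightarrow> ('m set \<times> ('m \<Rightarrow> nat \<Rightarrow> real)) set \<Rightarrow> ('m \<Rightarrow> complex) set" where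
  "mfd_test_functions Y d \<A> =
     {f. compactin Y (tsupport Y f) \<and>
         (\<forall>(U, \<phi>)\<in>\<A>. smooth_along {..<d} (\<phi> ` U) (\<lambda>x. f (inv_into U \<phi> x)))}"

definition mfd_seminorm ::
  "nat \<Rightarrow> (('m set \<times> ('m \<Rightarrow> nat \<Rightarrow> real)) \<times> 'm set \<times> nat) \<Rightarrow> ('m \<Rightarrow> complex) \<Rightarrow> real" where
  "mfd_seminorm d = (\<lambda>((U, \<phi>), L, N) f.
     SUP (is, x) \<in> {is. set is \<subseteq> {..<d} \<and> length is \<le> N} \<times> \<phi> ` L.
       cmod (partials is (\<lambda>x. f (inv_into U \<phi> x)) x))"

text \<open>Continuity for the inductive limit topology: for every compact \<open>K\<close>, the restriction to the
  test functions supported in \<open>K\<close> is bounded by finitely many of the seminorms that define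
  their Frechet space topology.\<close>

definition mfd_distributions ::
  "'m topology \<Rightarrow> nat \<Rightarrow> ('m set \<times> ('m \<Rightarrow> nat \<Rightarrow> real)) set \<Rightarrow> (('m \<Rightarrow> complex) \<Rightarrow> complex) set" where
  "mfd_distributions Y d \<A> =
     {u. linear_functional_on (mfd_test_functions Y d \<A>) u \<and>
         (\<forall>K. compactin Y K \<longrightarrow>
            (\<exists>C P. finite P \<and>
               P \<subseteq> {((U, \<phi>), L, N). (U, \<phi>) \<in> \<A> \<and> compactin Y L \<and> L \<noteq> {} \<and> L \<subseteq> U} \<and>
               (\<forall>f\<in>mfd_test_functions Y d \<A>. tsupport Y f \<subseteq> K \<longrightarrow>
                  cmod (u f) \<le> C * (\<Sum>p\<in>P. mfd_seminorm d p f))))}"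


section \<open>Products of lines, circles and integers\<close>

datatype factor = Line | Circle | Integers

fun dual_factor :: "factor \<Rightarrow> factor" where
  "dual_factor Line = Line"
| "dual_factor Circle = Integers"
| "dual_factor Integers = Circle"

text \<open>The family of factors of the dual group.\<close>

definition dual_group :: "('n \<Rightarrow> factor) \<Rightarrow> 'n \<Rightarrow> factor" where
  "dual_group G = (\<lambda>i. dual_factor (G i))"

text \<open>The circle \<open>\<real>/\<int>\<close> is represented by \<open>{0..<1}\<close> with the quotient topology of
  \<^term>\<open>frac :: real \<Rightarrow> real\<close>.\<close>

definition circle_topology :: "real topology" where
  "circle_topology = topology (\<lambda>U. U \<subseteq> {0..<1} \<and> open ((frac :: real \<Rightarrow> real) -` U))"

lemma openin_circle_topology:
  "openin circle_topology U \<longleftrightarrow> U \<subseteq> {0..<1} \<and> open ((frac :: real \<Rightarrow> real) -` U)"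
proof -
  have "istopology (\<lambda>U. U \<subseteq> {0..<1} \<and> open ((frac :: real \<Rightarrow> real) -` U))"
    unfolding istopology_def by (auto simp: vimage_Union vimage_Int)
  then show ?thesis
    by (simp add: circle_topology_def topology_inverse')
qed

lemma topspace_circle_topology: "topspace circle_topology = {0..<1}"
proof -
  have "(frac :: real \<Rightarrow> real) -` {0..<1} = UNIV"
    by (auto simp: frac_lt_1)
  then have "openin circle_topology {0..<1}"
    by (simp add: openin_circle_topology)
  then show ?thesis
    by (metis openin_circle_topology openin_subset openin_topspace subset_antisym)
qed

fun factor_topology :: "factor \<Rightarrow> real topology" where
  "factor_topology Line = euclideanreal"
| "factor_topology Circle = circle_topology"
| "factor_topology Integers = discrete_topology \<int>"

fun factor_measure :: "factor \<Rightarrow> real measure" where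
  "factor_measure Line = lborel"
| "factor_measure Circle = restrict_space lborel {0..<1}"
| "factor_measure Integers = count_space \<int>"

definition group_topology :: "('n::finite \<Rightarrow> factor) \<Rightarrow> ('n \<Rightarrow> real) topology" where
  "group_topology H = product_topology (\<lambda>i. factor_topology (H i)) UNIV"

text \<open>The completion matters for functions with values in a nonseparable Banach space: changing
  such a function on a null set must not destroy its measurability.\<close>

definition haar :: "('n::finite \<Rightarrow> factor) \<Rightarrow> ('n \<Rightarrow> real) measure" where
  "haar H = completion (\<Pi>\<^sub>M i\<in>UNIV. factor_measure (H i))"

lemma space_haar: "space (haar H) = topspace (group_topology H)"
proof -
  have "space (factor_measure k) = topspace (factor_topology k)" for k
    by (cases k) (auto simp: topspace_circle_topology)
  then show ?thesis
    by (simp add: haar_def group_topology_def space_PiM)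
qed


section \<open>Smooth functions and distributions on these groups\<close>

text \<open>Functions on the group are lifted to functions periodic in the circle coordinates.\<close>

definition unroll :: "('n \<Rightarrow> factor) \<Rightarrow> (('n \<Rightarrow> real) \<Rightarrow> complex) \<Rightarrow> ('n \<Rightarrow> real) \<Rightarrow> complex" where
  "unroll H f x = f (\<lambda>i. if H i = Circle then frac (x i) else x i)"

definition cover :: "('n \<Rightarrow> factor) \<Rightarrow> ('n \<Rightarrow> real) set" where
  "cover H = {x. \<forall>i. H i = Integers \<longrightarrow> x i \<in> \<int>}"

definition diff_directions :: "('n \<Rightarrow> factor) \<Rightarrow> 'n set" where
  "diff_directions H = {i. H i \<noteq> Integers}"

definition group_smooth :: "('n \<Rightarrow> factor) \<Rightarrow> (('n \<Rightarrow> real) \<Rightarrow> complex) \<Rightarrow> bool" where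
  "group_smooth H f \<longleftrightarrow> smooth_along (diff_directions H) (cover H) (unroll H f)"

definition test_functions :: "('n::finite \<Rightarrow> factor) \<Rightarrow> (('n \<Rightarrow> real) \<Rightarrow> complex) set" where
  "test_functions H = {f. group_smooth H f \<and> compactin (group_topology H) (tsupport (group_topology H) f)}"

definition weighted_derivative ::
  "('n::finite \<Rightarrow> factor) \<Rightarrow> nat \<Rightarrow> (('n \<Rightarrow> real) \<Rightarrow> complex) \<Rightarrow> 'n list \<times> ('n \<Rightarrow> real) \<Rightarrow> real" where
  "weighted_derivative H k f = (\<lambda>(is, x). (1 + (\<Sum>i\<in>UNIV. \<bar>x i\<bar>)) ^ k * cmod (partials is (unroll H f) x))"

definition seminorm_indices :: "('n::finite \<Rightarrow> factor) \<Rightarrow> nat \<Rightarrow> ('n list \<times> ('n \<Rightarrow> real)) set" where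
  "seminorm_indices H N =
     {is. set is \<subseteq> diff_directions H \<and> length is \<le> N} \<times> topspace (group_topology H)"

text \<open>\<open>group_seminorm H k N\<close> controls derivatives up to order \<open>N\<close> with polynomial weight of degree
  \<open>k\<close>; the circle coordinates contribute at most a bounded factor to the weight.\<close>

definition group_seminorm ::
  "('n::finite \<Rightarrow> factor) \<Rightarrow> nat \<Rightarrow> nat \<Rightarrow> (('n \<Rightarrow> real) \<Rightarrow> complex) \<Rightarrow> real" where
  "group_seminorm H k N f = (SUP p\<in>seminorm_indices H N. weighted_derivative H k f p)"

definition distributions ::
  "('n::finite \<Rightarrow> factor) \<Rightarrow> ((('n \<Rightarrow> real) \<Rightarrow> complex) \<Rightarrow> complex) set" where
  "distributions H =
     {u. linear_functional_on (test_functions H) u \<and>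
         (\<forall>K. compactin (group_topology H) K \<longrightarrow>
            (\<exists>C N. \<forall>f\<in>test_functions H. tsupport (group_topology H) f \<subseteq> K \<longrightarrow>
               cmod (u f) \<le> C * group_seminorm H 0 N f))}"

definition schwartz_functions :: "('n::finite \<Rightarrow> factor) \<Rightarrow> (('n \<Rightarrow> real) \<Rightarrow> complex) set" where
  "schwartz_functions H =
     {f. group_smooth H f \<and> (\<forall>k N. bdd_above (weighted_derivative H k f ` seminorm_indices H N))}"

definition tempered_distributions ::
  "('n::finite \<Rightarrow> factor) \<Rightarrow> ((('n \<Rightarrow> real) \<Rightarrow> complex) \<Rightarrow> complex) set" where
  "tempered_distributions H =
     {u. linear_functional_on (schwartz_functions H) u \<and>
         (\<exists>C k N. \<forall>f\<in>schwartz_functions H. cmod (u f) \<le> C * group_seminorm H k N f)}"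

definition nonneg_distribution ::
  "('n::finite \<Rightarrow> factor) \<Rightarrow> ((('n \<Rightarrow> real) \<Rightarrow> complex) \<Rightarrow> complex) \<Rightarrow> bool" where
  "nonneg_distribution H u \<longleftrightarrow>
     (\<forall>f\<in>test_functions H. (\<forall>x\<in>topspace (group_topology H). f x \<in> \<real>\<^sub>\<ge>\<^sub>0) \<longrightarrow> u f \<in> \<real>\<^sub>\<ge>\<^sub>0)"


section \<open>Locally Bochner integrable functions\<close>

text \<open>The library's Bochner integral is restricted to second countable spaces.\<close>

definition bochner_integrable :: "'a measure \<Rightarrow> ('a \<Rightarrow> 'b::banach) \<Rightarrow> bool" where
  "bochner_integrable M f \<longleftrightarrow>
     (\<exists>s. (\<forall>j. Bochner_Integration.simple_bochner_integrable M (s j)) \<and>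
          (AE x in M. (\<lambda>j. s j x) \<longlonglongrightarrow> f x) \<and>
          (\<lambda>j. \<integral>\<^sup>+ x. ennreal (norm (f x - s j x)) \<partial>M) \<longlonglongrightarrow> 0)"

definition L1_loc :: "('n::finite \<Rightarrow> factor) \<Rightarrow> (('n \<Rightarrow> real) \<Rightarrow> 'b::banach) set" where
  "L1_loc H =
     {f. \<forall>K. compactin (group_topology H) K \<longrightarrow> bochner_integrable (haar H) (\<lambda>x. indicat_real K x *\<^sub>R f x)}"

definition distribution_of ::
  "('n::finite \<Rightarrow> factor) \<Rightarrow> (('n \<Rightarrow> real) \<Rightarrow> complex) \<Rightarrow> (('n \<Rightarrow> real) \<Rightarrow> complex) \<Rightarrow> complex" where
  "distribution_of H f \<phi> = (\<integral>x. f x * \<phi> x \<partial>haar H)"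


section \<open>The spaces \<open>\<Xi>\<close>\<close>

text \<open>Below, \<open>\<Xi>\<close> is given by an embedding \<open>\<iota>\<close> into the tempered distributions. The element \<open>x\<close> of
  \<open>\<Xi>\<close>, considered as a distribution, is \<open>u\<close>:\<close>

definition is_distribution ::
  "('n::finite \<Rightarrow> factor) \<Rightarrow> ('x::complex_banach \<Rightarrow> (('n \<Rightarrow> real) \<Rightarrow> complex) \<Rightarrow> complex)
     \<Rightarrow> 'x \<Rightarrow> ((('n \<Rightarrow> real) \<Rightarrow> complex) \<Rightarrow> complex) \<Rightarrow> bool" where
  "is_distribution H \<iota> x u \<longleftrightarrow> (\<forall>\<phi>\<in>test_functions H. \<iota> x \<phi> = u \<phi>)"

text \<open>At most one \<open>x\<close> satisfies this (the test functions are dense in the Schwartz-Bruhat space),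
  so the infimum is its norm if it exists, and \<open>\<infinity>\<close> otherwise.\<close>

definition ext_norm ::
  "('n::finite \<Rightarrow> factor) \<Rightarrow> ('x::complex_banach \<Rightarrow> (('n \<Rightarrow> real) \<Rightarrow> complex) \<Rightarrow> complex)
     \<Rightarrow> ((('n \<Rightarrow> real) \<Rightarrow> complex) \<Rightarrow> complex) \<Rightarrow> ennreal" where
  "ext_norm H \<iota> u = (INF x\<in>{x. is_distribution H \<iota> x u}. ennreal (norm x))"

definition pointwise_norm :: "('a \<Rightarrow> 'b::real_normed_vector) \<Rightarrow> 'a \<Rightarrow> complex" where
  "pointwise_norm f x = complex_of_real (norm (f x))"

definition vector_Xi ::
  "('n::finite \<Rightarrow> factor) \<Rightarrow> ('x::complex_banach \<Rightarrow> (('n \<Rightarrow> real) \<Rightarrow> complex) \<Rightarrow> complex)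
     \<Rightarrow> (('n \<Rightarrow> real) \<Rightarrow> 'b::banach) set" where
  "vector_Xi H \<iota> =
     {f \<in> L1_loc H. \<exists>x. is_distribution H \<iota> x (distribution_of H (pointwise_norm f))}"

definition vector_norm ::
  "('n::finite \<Rightarrow> factor) \<Rightarrow> ('x::complex_banach \<Rightarrow> (('n \<Rightarrow> real) \<Rightarrow> complex) \<Rightarrow> complex)
     \<Rightarrow> (('n \<Rightarrow> real) \<Rightarrow> 'b::banach) \<Rightarrow> ennreal" where
  "vector_norm H \<iota> f = ext_norm H \<iota> (distribution_of H (pointwise_norm f))"


section \<open>Convergence in measure\<close>

text \<open>On an infinite measure space, convergence in measure is understood either globally or on all
  sets of finite measure.\<close>

datatype measure_mode = Global | Local

fun mode_sets :: "measure_mode \<Rightarrow> 'a measure \<Rightarrow> 'a set set" where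
  "mode_sets Global M = {space M}"
| "mode_sets Local M = {A \<in> sets M. emeasure M A < \<infinity>}"

definition tendsto_in_measure ::
  "measure_mode \<Rightarrow> 'a measure \<Rightarrow> (nat \<Rightarrow> 'a \<Rightarrow> 'b::real_normed_vector) \<Rightarrow> ('a \<Rightarrow> 'b) \<Rightarrow> bool" where
  "tendsto_in_measure mode M f g \<longleftrightarrow>
     (\<forall>A\<in>mode_sets mode M. \<forall>\<epsilon>>0. (\<lambda>m. emeasure M {x \<in> A. norm (f m x - g x) > \<epsilon>}) \<longlonglongrightarrow> 0)"

text \<open>Since \<open>\<Xi>\<close> is metrizable, continuity is the same as sequential continuity. The functions
  \<open>f m\<close> and \<open>g\<close> are arbitrary representatives of the classes that \<open>x m\<close> and \<open>y\<close> correspond to.\<close>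

definition continuous_into_L0 ::
  "measure_mode \<Rightarrow> ('n::finite \<Rightarrow> factor)
     \<Rightarrow> ('x::complex_banach \<Rightarrow> (('n \<Rightarrow> real) \<Rightarrow> complex) \<Rightarrow> complex) \<Rightarrow> bool" where
  "continuous_into_L0 mode H \<iota> \<longleftrightarrow>
     (\<forall>x y f g.
        (\<forall>m. f m \<in> L1_loc H \<and> is_distribution H \<iota> (x m) (distribution_of H (f m))) \<and>
        g \<in> L1_loc H \<and> is_distribution H \<iota> y (distribution_of H g) \<and> x \<longlonglongrightarrow> y
        \<longrightarrow> tendsto_in_measure mode (haar H) f g)"

end

theory Submission
  imports Defs
begin

text \<open>
  The argument is the proof that \<open>L\<^sup>1\<close> is complete, with the norm of \<open>\<Xi>\<close> in place of the integral and
  continuity of \<open>\<Xi> \<rightarrow> L\<^sup>0\<close> in place of the monotone convergence theorem.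

  Pass to a subsequence \<open>w j = u (r j)\<close> with \<open>\<parallel>w (j + 1) - w j\<parallel> < 2\<^sup>-\<^sup>j\<close> in \<open>\<Xi>(\<Y>)\<close>. The functions
  \<open>d j = \<parallel>w (j + 1) - w j\<parallel>\<close> then form an absolutely convergent series in the Banach space \<open>\<Xi>\<close>. Its
  sum is represented by a locally integrable function \<open>g\<close>, and the partial sums tend to \<open>g\<close> in
  measure (lemma \<open>Xi_series_tendsto_in_measure\<close>). As they increase, they tend to \<open>g\<close> almost
  everywhere; hence \<open>w j\<close> has finite total variation \<open>|g|\<close> almost everywhere, converges to some \<open>v\<close>,
  and \<open>\<parallel>v - w j\<parallel> \<le> |g|\<close>. Dominated convergence on compact sets makes \<open>v\<close> locally Bochner integrable.

  For the same reason \<open>\<parallel>v\<parallel> \<le> \<parallel>w 0\<parallel> + g\<close> almost everywhere, and \<open>g \<ge> 0\<close> as a limit of nonnegative functions.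
  The right-hand side belongs to \<open>\<Xi>\<close>, hence its extended norm is finite, and
  so is that of \<open>\<parallel>v\<parallel>\<close>, by quasi-monotonicity.
  A finite extended norm means membership in \<open>\<Xi>\<close> (lemma \<open>representable_if_dominated\<close>), so \<open>v\<close> belongs
  to \<open>\<Xi>(\<Y>)\<close>.

  Finally, by continuity of \<open>\<Xi> \<rightarrow> L\<^sup>0\<close> at \<open>0\<close>, the whole sequence \<open>u\<close> is Cauchy in measure, and Fatou's
  lemma transfers the estimate for \<open>u m - u (r j)\<close> to the limit \<open>u m - v\<close>. This works on sets of infinite
  measure too, where almost everywhere convergence alone would not give convergence in measure.

  The extended norm of a distribution is an infimum over the elements of \<open>\<Xi>\<close> that represent it. The
  proof picks elements of nearly minimal norm for the functions \<open>d j\<close> and adds them up, which relies on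
  linearity of the representation on test functions, and for this on the fact that test functions are
  Schwartz-Bruhat functions.
\<close>

section \<open>Bochner integrability over a complete measure\<close>

lemma bochner_integrableE:
  assumes "bochner_integrable M f"
  obtains s where "\<And>j. Bochner_Integration.simple_bochner_integrable M (s j)"
    "AE x in M. (\<lambda>j. s j x) \<longlonglongrightarrow> f x"
    "(\<lambda>j. \<integral>\<^sup>+ x. ennreal (norm (f x - s j x)) \<partial>M) \<longlonglongrightarrow> 0"
  using assms unfolding bochner_integrable_def by blast

lemma bochner_integrable_simple:
  "Bochner_Integration.simple_bochner_integrable M s \<Longrightarrow> bochner_integrable M s"
  unfolding bochner_integrable_def by (rule exI[of _ "\<lambda>_. s"]) auto

lemma bochner_integrable_zero: "bochner_integrable M (\<lambda>x. 0)"
  by (rule bochner_integrable_simple) (auto intro: simple_bochner_integrable.intros)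

context complete_measure
begin

lemma borel_measurable_cong_AE:
  fixes f g :: "'a \<Rightarrow> 'b::topological_space"
  assumes f: "f \<in> borel_measurable M" and ae: "AE x in M. f x = g x"
  shows "g \<in> borel_measurable M"
proof (rule measurableI)
  fix S :: "'b set" assume S: "S \<in> sets borel"
  have "f -` S \<inter> space M \<in> sets M"
    using f S by (rule measurable_sets)
  moreover have "AE x in M. (x \<in> f -` S \<inter> space M) = (x \<in> g -` S \<inter> space M)"
    using ae by eventually_elim auto
  ultimately show "g -` S \<inter> space M \<in> sets M"
    using in_sets_AE by blast
qed auto

lemma borel_measurable_AE_LIMSEQ:
  fixes f :: "nat \<Rightarrow> 'a \<Rightarrow> 'b::metric_space"
  assumes f: "\<And>j. f j \<in> borel_measurable M" and lim: "AE x in M. (\<lambda>j. f j x) \<longlonglongrightarrow> g x"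
  shows "g \<in> borel_measurable M"
proof -
  obtain N where N: "N \<in> null_sets M" "{x \<in> space M. \<not> (\<lambda>j. f j x) \<longlonglongrightarrow> g x} \<subseteq> N"
    using lim by (auto simp: eventually_ae_filter)
  have "(\<lambda>x. if x \<in> N then undefined else g x) \<in> borel_measurable M"
  proof (rule borel_measurable_LIMSEQ_metric)
    show "(\<lambda>x. if x \<in> N then undefined else f j x) \<in> borel_measurable M" for j
      using f[of j] N(1) by (intro measurable_If_set) auto
    show "(\<lambda>j. if x \<in> N then undefined else f j x) \<longlonglongrightarrow> (if x \<in> N then undefined else g x)"
      if "x \<in> space M" for x
      using N(2) that by auto
  qed
  moreover have "AE x in M. (if x \<in> N then undefined else g x) = g x"
    using AE_not_in[OF N(1)] by eventually_elim auto
  ultimately show ?thesis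
    by (rule borel_measurable_cong_AE)
qed

text \<open>In a nonseparable space, subtraction need not be measurable for the product of the Borel
  \<open>\<sigma>\<close>-algebras, so measurability of \<open>f\<close> and \<open>g\<close> does not give that of the distance. It is obtained as
  a limit of distances between simple functions, almost everywhere, which is where completeness of the
  measure is needed.\<close>

lemma bochner_integrable_measurable_norm_diff:
  assumes "bochner_integrable M f" "bochner_integrable M g"
  shows "(\<lambda>x. norm (f x - g x)) \<in> borel_measurable M"
proof -
  obtain s where
    s: "\<And>j. Bochner_Integration.simple_bochner_integrable M (s j)" "AE x in M. (\<lambda>j. s j x) \<longlonglongrightarrow> f x"
    using assms(1) by (rule bochner_integrableE) (rule that)
  obtain t where
    t: "\<And>j. Bochner_Integration.simple_bochner_integrable M (t j)" "AE x in M. (\<lambda>j. t j x) \<longlonglongrightarrow> g x"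
    using assms(2) by (rule bochner_integrableE) (rule that)
  have "Bochner_Integration.simple_bochner_integrable M (\<lambda>x. norm (s j x - t j x))" for j
    using simple_bochner_integrable_compose2[of "\<lambda>x y. norm (x - y)", OF _ s(1) t(1)] by simp
  then have "(\<lambda>x. norm (s j x - t j x)) \<in> borel_measurable M" for j
    by (auto elim: simple_bochner_integrable.cases intro: borel_measurable_simple_function)
  moreover have "AE x in M. (\<lambda>j. norm (s j x - t j x)) \<longlonglongrightarrow> norm (f x - g x)"
    using s(2) t(2) by eventually_elim (intro tendsto_intros)
  ultimately show ?thesis
    by (rule borel_measurable_AE_LIMSEQ)
qed

text \<open>One lemma for sums, differences and norms: a nonexpansive map that fixes \<open>0\<close> turns simple
  approximations of \<open>f\<close> and \<open>g\<close> into simple approximations of the image.\<close>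

lemma bochner_integrable_nonexpansive:
  assumes f: "bochner_integrable M f" and g: "bochner_integrable M g"
    and p0: "p 0 0 = 0"
    and p: "\<And>a b a' b'. norm (p a b - p a' b') \<le> norm (a - a') + norm (b - b')"
  shows "bochner_integrable M (\<lambda>x. p (f x) (g x))"
proof -
  obtain s where
    s: "\<And>j. Bochner_Integration.simple_bochner_integrable M (s j)" "AE x in M. (\<lambda>j. s j x) \<longlonglongrightarrow> f x"
       "(\<lambda>j. \<integral>\<^sup>+ x. ennreal (norm (f x - s j x)) \<partial>M) \<longlonglongrightarrow> 0"
    using f by (rule bochner_integrableE) (rule that)
  obtain t where
    t: "\<And>j. Bochner_Integration.simple_bochner_integrable M (t j)" "AE x in M. (\<lambda>j. t j x) \<longlonglongrightarrow> g x"
       "(\<lambda>j. \<integral>\<^sup>+ x. ennreal (norm (g x - t j x)) \<partial>M) \<longlonglongrightarrow> 0"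
    using g by (rule bochner_integrableE) (rule that)
  have meas: "(\<lambda>x. norm (f x - s j x)) \<in> borel_measurable M" "(\<lambda>x. norm (g x - t j x)) \<in> borel_measurable M" for j
    by (intro bochner_integrable_measurable_norm_diff f g bochner_integrable_simple s t)+
  have "AE x in M. (\<lambda>j. p (s j x) (t j x)) \<longlonglongrightarrow> p (f x) (g x)"
    using s(2) t(2)
  proof eventually_elim
    case (elim x)
    have "(\<lambda>j. norm (s j x - f x) + norm (t j x - g x)) \<longlonglongrightarrow> 0"
      using elim by (auto intro!: tendsto_add_zero simp: tendsto_norm_zero_iff LIM_zero_iff)
    then have "(\<lambda>j. p (s j x) (t j x) - p (f x) (g x)) \<longlonglongrightarrow> 0"
      by (rule Lim_null_comparison[rotated]) (auto simp: p)
    then show ?case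
      by (simp add: LIM_zero_iff)
  qed
  moreover have "(\<lambda>j. \<integral>\<^sup>+ x. ennreal (norm (p (f x) (g x) - p (s j x) (t j x))) \<partial>M) \<longlonglongrightarrow> 0"
  proof (rule tendsto_sandwich[where f = "\<lambda>_. 0"])
    show "(\<lambda>j. (\<integral>\<^sup>+ x. ennreal (norm (f x - s j x)) \<partial>M) + (\<integral>\<^sup>+ x. ennreal (norm (g x - t j x)) \<partial>M)) \<longlonglongrightarrow> 0"
      using tendsto_add[OF s(3) t(3)] by simp
    have "(\<integral>\<^sup>+ x. ennreal (norm (p (f x) (g x) - p (s j x) (t j x))) \<partial>M)
        \<le> (\<integral>\<^sup>+ x. (ennreal (norm (f x - s j x)) + ennreal (norm (g x - t j x))) \<partial>M)" for j
      by (intro nn_integral_mono) (simp add: p flip: ennreal_plus)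
    also have "\<dots> j = (\<integral>\<^sup>+ x. ennreal (norm (f x - s j x)) \<partial>M) + (\<integral>\<^sup>+ x. ennreal (norm (g x - t j x)) \<partial>M)" for j
      using meas by (intro nn_integral_add) auto
    finally show "\<forall>\<^sub>F j in sequentially. (\<integral>\<^sup>+ x. ennreal (norm (p (f x) (g x) - p (s j x) (t j x))) \<partial>M)
        \<le> (\<integral>\<^sup>+ x. ennreal (norm (f x - s j x)) \<partial>M) + (\<integral>\<^sup>+ x. ennreal (norm (g x - t j x)) \<partial>M)"
      by simp
  qed auto
  moreover have "\<And>j. Bochner_Integration.simple_bochner_integrable M (\<lambda>x. p (s j x) (t j x))"
    by (rule simple_bochner_integrable_compose2[where p = p, OF p0 s(1) t(1)])
  ultimately show ?thesis
    unfolding bochner_integrable_def by (intro exI[of _ "\<lambda>j x. p (s j x) (t j x)"]) blast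
qed

lemma bochner_integrable_imp_integrable:
  fixes f :: "'a \<Rightarrow> 'b::{banach, second_countable_topology}"
  assumes "bochner_integrable M f"
  shows "integrable M f"
proof -
  obtain s where
    s: "\<And>j. Bochner_Integration.simple_bochner_integrable M (s j)" "AE x in M. (\<lambda>j. s j x) \<longlonglongrightarrow> f x"
       "(\<lambda>j. \<integral>\<^sup>+ x. ennreal (norm (f x - s j x)) \<partial>M) \<longlonglongrightarrow> 0"
    using assms by (rule bochner_integrableE) (rule that)
  have "s j \<in> borel_measurable M" for j
    using s(1)[of j] by (auto elim: simple_bochner_integrable.cases intro: borel_measurable_simple_function)
  then have [measurable]: "f \<in> borel_measurable M"
    using s(2) by (rule borel_measurable_AE_LIMSEQ)
  have int_s: "integrable M (s j)" for j
    using has_bochner_integral_simple_bochner_integrable[OF s(1)] by (rule integrable.intros)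
  obtain j where j: "(\<integral>\<^sup>+ x. ennreal (norm (f x - s j x)) \<partial>M) < 1"
    using order_tendstoD(2)[OF s(3), of 1] by (auto simp: eventually_sequentially)
  have "integrable M (\<lambda>x. f x - s j x)"
    using int_s[of j] j by (auto simp: integrable_iff_bounded intro: order.strict_trans)
  from Bochner_Integration.integrable_add[OF this int_s[of j]] show ?thesis
    by simp
qed

text \<open>The sum of the functions has a finite integral, so it is finite almost everywhere.\<close>

lemma AE_tendsto_zero_if_nn_integral_fast:
  fixes a :: "nat \<Rightarrow> 'a \<Rightarrow> real"
  assumes [measurable]: "\<And>j. a j \<in> borel_measurable M" and nonneg: "\<And>j x. a j x \<ge> 0"
    and fast: "(\<Sum>j. \<integral>\<^sup>+ x. ennreal (a j x) \<partial>M) < \<infinity>"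
  shows "AE x in M. (\<lambda>j. a j x) \<longlonglongrightarrow> 0"
proof -
  have "(\<integral>\<^sup>+ x. (\<Sum>j. ennreal (a j x)) \<partial>M) \<noteq> \<infinity>"
    using fast by (subst nn_integral_suminf) auto
  then have "AE x in M. (\<Sum>j. ennreal (a j x)) \<noteq> \<infinity>"
    by (intro nn_integral_PInf_AE) auto
  then show ?thesis
    by eventually_elim (auto intro!: summable_LIMSEQ_zero summable_suminf_not_top nonneg)
qed

lemma borel_measurable_norm_diff_AE_limit:
  assumes f: "\<And>j. bochner_integrable M (f j)" and ae: "AE x in M. (\<lambda>j. f j x) \<longlonglongrightarrow> g x"
    and s: "bochner_integrable M s"
  shows "(\<lambda>x. norm (g x - s x)) \<in> borel_measurable M"
proof (rule borel_measurable_AE_LIMSEQ)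
  show "(\<lambda>x. norm (f j x - s x)) \<in> borel_measurable M" for j
    by (intro bochner_integrable_measurable_norm_diff f s)
  show "AE x in M. (\<lambda>j. norm (f j x - s x)) \<longlonglongrightarrow> norm (g x - s x)"
    using ae by eventually_elim (intro tendsto_intros)
qed

text \<open>Each \<open>f j\<close> is close to a simple function, which gives simple functions at distance less than
  \<open>2\<^sup>-\<^sup>j\<close> from \<open>g\<close>; this rate turns convergence in the mean into convergence almost everywhere.
  That \<open>f j\<close> converges almost everywhere makes the distances to \<open>g\<close> measurable.\<close>

lemma bochner_integrable_L1_limit:
  assumes f: "\<And>j. bochner_integrable M (f j)" and ae: "AE x in M. (\<lambda>j. f j x) \<longlonglongrightarrow> g x"
    and L1: "(\<lambda>j. \<integral>\<^sup>+ x. ennreal (norm (g x - f j x)) \<partial>M) \<longlonglongrightarrow> 0"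
  shows "bochner_integrable M g"
proof -
  note meas = borel_measurable_norm_diff_AE_limit[OF f ae]
  have "\<exists>s. Bochner_Integration.simple_bochner_integrable M s \<and>
      (\<integral>\<^sup>+ x. ennreal (norm (g x - s x)) \<partial>M) < ennreal ((1/2)^j)" for j
  proof -
    have pos: "0 < ennreal ((1/2)^Suc j)" by (subst ennreal_0[symmetric], subst ennreal_less_iff) auto
    obtain r where r: "(\<integral>\<^sup>+ x. ennreal (norm (g x - f r x)) \<partial>M) < ennreal ((1/2)^Suc j)"
      using order_tendstoD(2)[OF L1 pos] by (auto simp: eventually_sequentially)
    obtain t where t: "\<And>i. Bochner_Integration.simple_bochner_integrable M (t i)"
       "(\<lambda>i. \<integral>\<^sup>+ x. ennreal (norm (f r x - t i x)) \<partial>M) \<longlonglongrightarrow> 0"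
      using f[of r] by (rule bochner_integrableE) (rule that)
    obtain i where i: "(\<integral>\<^sup>+ x. ennreal (norm (f r x - t i x)) \<partial>M) < ennreal ((1/2)^Suc j)"
      using order_tendstoD(2)[OF t(2) pos] by (auto simp: eventually_sequentially)
    have "(\<integral>\<^sup>+ x. ennreal (norm (g x - t i x)) \<partial>M)
        \<le> (\<integral>\<^sup>+ x. (ennreal (norm (g x - f r x)) + ennreal (norm (f r x - t i x))) \<partial>M)"
      using norm_triangle_ineq[of "g x - f r x" "f r x - t i x" for x]
      by (intro nn_integral_mono) (simp flip: ennreal_plus)
    also have "\<dots> = (\<integral>\<^sup>+ x. ennreal (norm (g x - f r x)) \<partial>M) + (\<integral>\<^sup>+ x. ennreal (norm (f r x - t i x)) \<partial>M)"
      using meas[OF f[of r]] bochner_integrable_measurable_norm_diff[OF f[of r] bochner_integrable_simple[OF t(1)[of i]]]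
      by (intro nn_integral_add) auto
    also have "\<dots> < ennreal ((1/2)^Suc j) + ennreal ((1/2)^Suc j)"
      using r i by (rule add_strict_mono)
    also have "\<dots> = ennreal ((1/2)^j)"
      by (simp flip: ennreal_plus)
    finally show ?thesis
      using t(1) by blast
  qed
  then obtain s where s: "\<And>j. Bochner_Integration.simple_bochner_integrable M (s j)"
    and close: "\<And>j. (\<integral>\<^sup>+ x. ennreal (norm (g x - s j x)) \<partial>M) < ennreal ((1/2)^j)"
    by metis
  have "(\<lambda>j. \<integral>\<^sup>+ x. ennreal (norm (g x - s j x)) \<partial>M) \<longlonglongrightarrow> 0"
  proof (rule tendsto_sandwich[where f = "\<lambda>_. 0"])
    show "(\<lambda>j. ennreal ((1/2)^j)) \<longlonglongrightarrow> 0"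
      by (subst ennreal_0[symmetric]) (intro tendsto_ennrealI LIMSEQ_realpow_zero, auto)
    show "\<forall>\<^sub>F j in sequentially. (\<integral>\<^sup>+ x. ennreal (norm (g x - s j x)) \<partial>M) \<le> ennreal ((1/2)^j)"
      by (intro always_eventually allI less_imp_le close)
  qed auto
  moreover have "AE x in M. (\<lambda>j. norm (g x - s j x)) \<longlonglongrightarrow> 0"
  proof (rule AE_tendsto_zero_if_nn_integral_fast)
    have "(\<Sum>j. \<integral>\<^sup>+ x. ennreal (norm (g x - s j x)) \<partial>M) \<le> (\<Sum>j. ennreal ((1/2)^j))"
      by (intro suminf_le less_imp_le[OF close] summableI)
    also have "\<dots> < \<infinity>"
      unfolding infinity_ennreal_def less_top[symmetric]
      by (rule ennreal_suminf_neq_top) (simp_all add: summable_geometric)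
    finally show "(\<Sum>j. \<integral>\<^sup>+ x. ennreal (norm (g x - s j x)) \<partial>M) < \<infinity>" .
  qed (rule meas bochner_integrable_simple s norm_ge_zero)+
  then have "AE x in M. (\<lambda>j. s j x) \<longlonglongrightarrow> g x"
  proof eventually_elim
    case (elim x)
    then have "(\<lambda>j. norm (s j x - g x)) \<longlonglongrightarrow> 0"
      by (simp add: norm_minus_commute)
    then show ?case
      by (rule LIM_zero_cancel[OF tendsto_norm_zero_cancel])
  qed
  ultimately show ?thesis
    unfolding bochner_integrable_def using s by blast
qed

end

section \<open>Convergence in measure\<close>

text \<open>Convergence in measure does not give convergence almost everywhere, but it makes the terms come
  close to the limit infinitely often at almost every point: the set where they stay away by
  \<open>1 / (n + 1)\<close> from some index \<open>N\<close> on lies in sets of arbitrarily small measure.\<close>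

lemma tendsto_in_measure_AE_frequently:
  assumes sf: "sigma_finite_measure M" and conv: "tendsto_in_measure mode M f g"
    and meas: "\<And>m. (\<lambda>x. norm (f m x - g x)) \<in> borel_measurable M"
  shows "AE x in M. \<forall>\<epsilon>>0. \<exists>\<^sub>F m in sequentially. norm (f m x - g x) \<le> \<epsilon>"
proof -
  interpret sigma_finite_measure M by (rule sf)
  note meas[measurable]
  have "AE x in M. x \<in> A \<longrightarrow> (\<forall>\<epsilon>>0. \<exists>\<^sub>F m in sequentially. norm (f m x - g x) \<le> \<epsilon>)"
    if A: "A \<in> mode_sets mode M" for A
  proof -
    have [measurable]: "A \<in> sets M"
      using A by (cases mode) auto
    have "AE x in M. \<not> (x \<in> A \<and> (\<forall>m\<ge>N. norm (f m x - g x) > 1 / Suc n))" for n N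
    proof -
      let ?E = "\<lambda>m. {x\<in>A. norm (f m x - g x) > 1 / Suc n}"
      let ?B = "{x\<in>space M. x \<in> A \<and> (\<forall>m\<ge>N. norm (f m x - g x) > 1 / Suc n)}"
      have E: "?E m = {x\<in>space M. x \<in> A \<and> norm (f m x - g x) > 1 / Suc n}" for m
        using sets.sets_into_space[OF \<open>A \<in> sets M\<close>] by auto
      have "(\<lambda>m. emeasure M (?E m)) \<longlonglongrightarrow> 0"
        using conv A by (auto simp: tendsto_in_measure_def)
      moreover have "\<forall>\<^sub>F m in sequentially. emeasure M ?B \<le> emeasure M (?E m)"
        using eventually_ge_at_top[of N] unfolding E
        by eventually_elim (rule emeasure_mono, auto)
      ultimately have "emeasure M ?B \<le> 0"
        by (intro tendsto_lowerbound[of _ _ sequentially]) auto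
      then show ?thesis
        by (subst AE_iff_measurable[of ?B]) auto
    qed
    then have "AE x in M. \<forall>n N. \<not> (x \<in> A \<and> (\<forall>m\<ge>N. norm (f m x - g x) > 1 / Suc n))"
      unfolding AE_all_countable by blast
    then show ?thesis
    proof eventually_elim
      case (elim x)
      show ?case
      proof (intro impI allI)
        fix \<epsilon> :: real assume "x \<in> A" "\<epsilon> > 0"
        obtain n where "1 / Suc n < \<epsilon>"
          using \<open>\<epsilon> > 0\<close> nat_approx_posE by metis
        moreover have "\<exists>m\<ge>N. norm (f m x - g x) \<le> 1 / Suc n" for N
          using elim \<open>x \<in> A\<close> by (meson not_less)
        ultimately show "\<exists>\<^sub>F m in sequentially. norm (f m x - g x) \<le> \<epsilon>"
          unfolding frequently_sequentially by (meson less_imp_le order_trans)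
      qed
    qed
  qed
  note * = this
  \<comment> \<open>In the local mode, convergence is only known on sets of finite measure, and countably many
    of them have to cover the space.\<close>
  obtain A :: "nat \<Rightarrow> 'a set" where A: "range A \<subseteq> mode_sets mode M" "space M = (\<Union>i. A i)"
  proof (cases mode)
    case Global then show ?thesis by (intro that[of "\<lambda>_. space M"]) auto
  next
    case Local
    obtain A :: "nat \<Rightarrow> 'a set" where "range A \<subseteq> sets M" "(\<Union>i. A i) = space M" "\<And>i. emeasure M (A i) \<noteq> \<infinity>"
      using sigma_finite by blast
    with Local show ?thesis by (intro that[of A]) (auto simp: less_top)
  qed
  have "AE x in M. \<forall>i. x \<in> A i \<longrightarrow> (\<forall>\<epsilon>>0. \<exists>\<^sub>F m in sequentially. norm (f m x - g x) \<le> \<epsilon>)"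
    unfolding AE_all_countable using * A(1) by blast
  then show ?thesis
    using AE_space by eventually_elim (use A(2) in blast)
qed

lemma LIMSEQ_unique_frequently:
  fixes X :: "nat \<Rightarrow> 'b::real_normed_vector"
  assumes "X \<longlonglongrightarrow> a" "\<forall>\<epsilon>>0. \<exists>\<^sub>F m in sequentially. norm (X m - b) \<le> \<epsilon>"
  shows "a = b"
proof (rule ccontr)
  assume "a \<noteq> b"
  define e where "e = norm (a - b) / 3"
  have "e > 0" using \<open>a \<noteq> b\<close> by (simp add: e_def)
  then have "\<exists>\<^sub>F m in sequentially. norm (X m - b) \<le> e" "\<forall>\<^sub>F m in sequentially. norm (X m - a) < e"
    using assms by (auto simp: tendsto_iff dist_norm)
  then have "\<exists>\<^sub>F m in sequentially. norm (X m - b) \<le> e \<and> norm (X m - a) < e"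
    by (rule frequently_eventually_frequently)
  then obtain m where "norm (X m - a) < e" "norm (X m - b) \<le> e"
    using frequently_ex by blast
  then have "norm (a - b) \<le> e + e"
    using norm_triangle_ineq[of "a - X m" "X m - b"] by (simp add: norm_minus_commute)
  then show False
    using \<open>e > 0\<close> by (simp add: e_def)
qed

text \<open>For increasing sequences, being close to the limit infinitely often already implies convergence.\<close>

lemma tendsto_in_measure_incseq_AE:
  fixes f :: "nat \<Rightarrow> 'a \<Rightarrow> real" and g :: "'a \<Rightarrow> complex"
  assumes sf: "sigma_finite_measure M"
    and conv: "tendsto_in_measure mode M (\<lambda>m x. complex_of_real (f m x)) g"
    and meas: "\<And>m. (\<lambda>x. norm (complex_of_real (f m x) - g x)) \<in> borel_measurable M"
    and mono: "\<And>x. incseq (\<lambda>m. f m x)"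
  shows "AE x in M. (\<lambda>m. complex_of_real (f m x)) \<longlonglongrightarrow> g x"
  using tendsto_in_measure_AE_frequently[OF sf conv meas]
proof eventually_elim
  case (elim x)
  have "f m x \<le> norm (g x) + 1" for m
  proof -
    obtain k where "k \<ge> m" "norm (complex_of_real (f k x) - g x) \<le> 1"
      using elim[rule_format, of 1] by (auto simp: frequently_sequentially)
    then have "norm (complex_of_real (f k x)) \<le> norm (g x) + 1"
      by (metis add.commute add_left_mono norm_triangle_sub order_trans)
    then show ?thesis
      using incseqD[OF mono \<open>k \<ge> m\<close>, of x] by simp
  qed
  then obtain a where "(\<lambda>m. f m x) \<longlonglongrightarrow> a"
    using incseq_convergent[OF mono] by metis
  then have "(\<lambda>m. complex_of_real (f m x)) \<longlonglongrightarrow> complex_of_real a"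
    by (rule tendsto_of_real)
  with LIMSEQ_unique_frequently[OF this elim] show ?case
    by simp
qed

text \<open>At almost every point where \<open>\<parallel>u m - v\<parallel> > \<epsilon>\<close>, also \<open>\<parallel>u m - u (r j)\<parallel> > \<epsilon>\<close> for all large \<open>j\<close>. Fatou's
  lemma for the indicator functions of these sets bounds the measure of the former by those of the
  latter, whatever the measure of \<open>A\<close>.\<close>

lemma tendsto_in_measure_if_Cauchy_and_AE_subseq:
  fixes u :: "nat \<Rightarrow> 'a \<Rightarrow> 'b::real_normed_vector"
  assumes Cauchy: "\<And>A \<epsilon> \<delta>. A \<in> mode_sets mode M \<Longrightarrow> \<epsilon> > 0 \<Longrightarrow> \<delta> > 0 \<Longrightarrow>
       \<exists>N. \<forall>m\<ge>N. \<forall>k\<ge>N. emeasure M {x\<in>A. norm (u m x - u k x) > \<epsilon>} \<le> \<delta>"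
    and meas: "\<And>m k. (\<lambda>x. norm (u m x - u k x)) \<in> borel_measurable M"
    and r: "strict_mono r" and lim: "AE x in M. (\<lambda>j. u (r j) x) \<longlonglongrightarrow> v x"
    and meas_v: "\<And>m. (\<lambda>x. norm (u m x - v x)) \<in> borel_measurable M"
  shows "tendsto_in_measure mode M u v"
  unfolding tendsto_in_measure_def
proof (intro ballI allI impI)
  fix A and \<epsilon> :: real assume A: "A \<in> mode_sets mode M" and "\<epsilon> > 0"
  have [measurable]: "A \<in> sets M"
    using A by (cases mode) auto
  note meas[measurable] meas_v[measurable]
  show "(\<lambda>m. emeasure M {x\<in>A. norm (u m x - v x) > \<epsilon>}) \<longlonglongrightarrow> 0"
  proof (rule order_tendstoI)
    fix \<delta> :: ennreal assume "0 < \<delta>"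
    then obtain \<delta>' where \<delta>': "0 < \<delta>'" "\<delta>' < \<delta>"
      using dense by blast
    obtain N where N: "\<And>m k. m \<ge> N \<Longrightarrow> k \<ge> N \<Longrightarrow> emeasure M {x\<in>A. norm (u m x - u k x) > \<epsilon>} \<le> \<delta>'"
      using Cauchy[OF A \<open>\<epsilon> > 0\<close> \<delta>'(1)] by blast
    have "emeasure M {x\<in>A. norm (u m x - v x) > \<epsilon>} \<le> \<delta>'" if "m \<ge> N" for m
    proof -
      let ?E = "\<lambda>j. {x\<in>space M. x \<in> A \<and> norm (u m x - u (r j) x) > \<epsilon>}"
      have A_eq: "{x\<in>A. P x} = {x\<in>space M. x \<in> A \<and> P x}" for P
        using sets.sets_into_space[OF \<open>A \<in> sets M\<close>] by auto
      have "emeasure M {x\<in>A. norm (u m x - v x) > \<epsilon>}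
          = (\<integral>\<^sup>+ x. indicator {x\<in>space M. x \<in> A \<and> norm (u m x - v x) > \<epsilon>} x \<partial>M)"
        unfolding A_eq by (rule nn_integral_indicator[symmetric]) measurable
      also have "\<dots> \<le> (\<integral>\<^sup>+ x. liminf (\<lambda>j. indicator (?E j) x) \<partial>M)"
      proof (rule nn_integral_mono_AE, use lim in eventually_elim)
        case (elim x)
        show ?case
        proof (cases "x \<in> space M \<and> x \<in> A \<and> norm (u m x - v x) > \<epsilon>")
          case True
          have "(\<lambda>j. norm (u m x - u (r j) x)) \<longlonglongrightarrow> norm (u m x - v x)"
            using elim by (intro tendsto_intros)
          then have "\<forall>\<^sub>F j in sequentially. norm (u m x - u (r j) x) > \<epsilon>"
            using True by (auto dest: order_tendstoD)
          then have "1 \<le> liminf (\<lambda>j. indicator (?E j) x :: ennreal)"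
            using True by (intro Liminf_bounded) (auto elim!: eventually_mono)
          then show ?thesis
            using True by simp
        qed auto
      qed
      also have "\<dots> \<le> liminf (\<lambda>j. \<integral>\<^sup>+ x. indicator (?E j) x \<partial>M)"
        by (rule nn_integral_liminf) measurable
      also have "\<dots> = liminf (\<lambda>j. emeasure M (?E j))"
        by (subst nn_integral_indicator) auto
      also have "\<dots> \<le> \<delta>'"
      proof (rule Liminf_le)
        show "\<forall>\<^sub>F j in sequentially. emeasure M (?E j) \<le> \<delta>'"
          using eventually_ge_at_top[of N]
        proof eventually_elim
          case (elim j)
          then have "r j \<ge> N"
            using seq_suble[OF r, of j] by linarith
          then show ?case
            using N[OF \<open>m \<ge> N\<close>] by (simp flip: A_eq)
        qed
      qed simp
      finally show ?thesis .
    qed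
    then show "\<forall>\<^sub>F m in sequentially. emeasure M {x\<in>A. norm (u m x - v x) > \<epsilon>} < \<delta>"
      unfolding eventually_sequentially using \<delta>'(2) by (meson order.strict_trans1)
  qed auto
qed

section \<open>Locally integrable functions on the group\<close>

lemma complete_measure_haar: "complete_measure (haar H)"
  unfolding haar_def by (rule completion.complete_measure_axioms)

lemma sigma_finite_haar: "sigma_finite_measure (haar H)"
proof -
  have "sigma_finite_measure (factor_measure k)" for k
    by (cases k) (auto simp: lborel.sigma_finite_measure_axioms countable_int
        intro!: sigma_finite_measure_restrict_space sigma_finite_measure_count_space_countable)
  then interpret product_sigma_finite "\<lambda>i. factor_measure (H i)"
    by (rule product_sigma_finite.intro)
  interpret P: sigma_finite_measure "\<Pi>\<^sub>M i\<in>UNIV. factor_measure (H i)"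
    by (rule sigma_finite) simp
  obtain A where A: "countable A" "A \<subseteq> sets (\<Pi>\<^sub>M i\<in>UNIV. factor_measure (H i))"
    "\<Union>A = space (\<Pi>\<^sub>M i\<in>UNIV. factor_measure (H i))"
    "\<forall>a\<in>A. emeasure (\<Pi>\<^sub>M i\<in>UNIV. factor_measure (H i)) a \<noteq> \<infinity>"
    using P.sigma_finite_countable by blast
  show ?thesis
    unfolding haar_def by standard (rule exI[of _ A], use A in \<open>auto simp: subset_eq\<close>)
qed

interpretation haar: complete_measure "haar H" for H :: "'n::finite \<Rightarrow> factor"
  by (rule complete_measure_haar)

lemma topspace_group_topology:
  "x \<in> topspace (group_topology H) \<longleftrightarrow> (\<forall>i. x i \<in> topspace (factor_topology (H i)))"
  by (auto simp: group_topology_def)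

text \<open>An exhaustion of the group by compact sets. The bound is at least \<open>1\<close>, so every box contains the
  circle factors entirely.\<close>

definition group_box :: "('n::finite \<Rightarrow> factor) \<Rightarrow> nat \<Rightarrow> ('n \<Rightarrow> real) set" where
  "group_box H n = {x \<in> topspace (group_topology H). \<forall>i. \<bar>x i\<bar> \<le> real (Suc n)}"

lemma continuous_map_frac_circle: "continuous_map euclideanreal circle_topology frac"
  unfolding continuous_map_def
  by (auto simp: topspace_circle_topology openin_circle_topology frac_lt_1 vimage_def)

lemma compactin_factor_interval:
  "compactin (factor_topology k) {t \<in> topspace (factor_topology k). \<bar>t\<bar> \<le> real (Suc n)}"
proof (cases k)
  case Line
  have "{t::real. \<bar>t\<bar> \<le> real (Suc n)} = {- real (Suc n)..real (Suc n)}"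
    by auto
  then show ?thesis
    unfolding Line by simp
next
  case Circle
  \<comment> \<open>The half-open interval carries the quotient topology, so it is the image of a compact interval.\<close>
  have "compactin euclideanreal {0..1}"
    by simp
  from image_compactin[OF this continuous_map_frac_circle]
  have "compactin circle_topology (frac ` {0..1::real})" .
  moreover have "frac ` {0..1::real} = {0..<1}"
  proof
    show "{0..<1} \<subseteq> frac ` {0..1::real}"
    proof
      fix t :: real assume "t \<in> {0..<1}"
      then have "frac t = t" "t \<in> {0..1}" by (auto simp: frac_eq)
      then show "t \<in> frac ` {0..1}" by (metis imageI)
    qed
  qed (auto simp: frac_lt_1)
  moreover have "{t \<in> {0..<1}. \<bar>t\<bar> \<le> real (Suc n)} = {0..<1}"
    by auto
  ultimately show ?thesis
    unfolding Circle by (simp only: factor_topology.simps topspace_circle_topology)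
next
  case Integers
  then show ?thesis
    using finite_abs_int_segment[of "real (Suc n)"] by (simp add: compactin_discrete_topology)
qed

lemma compactin_group_box: "compactin (group_topology H) (group_box H n)"
proof -
  have "group_box H n = (\<Pi>\<^sub>E i\<in>UNIV. {t \<in> topspace (factor_topology (H i)). \<bar>t\<bar> \<le> real (Suc n)})"
    by (auto simp: group_box_def topspace_group_topology PiE_def Pi_def)
  then show ?thesis
    by (simp only: group_topology_def compactin_PiE compactin_factor_interval) simp
qed

lemma compactin_group_bounded:
  assumes K: "compactin (group_topology H) K"
  obtains n where "K \<subseteq> group_box H n"
proof -
  have "\<exists>b::nat. \<forall>x\<in>K. \<bar>x i\<bar> \<le> real b" for i
  proof -
    have "compactin (factor_topology (H i)) ((\<lambda>x. x i) ` K)"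
      using K unfolding group_topology_def
      by (rule image_compactin) (rule continuous_map_product_projection, simp)
    then have "bounded ((\<lambda>x. x i) ` K)"
    proof (cases "H i")
      case Circle
      with \<open>compactin (factor_topology (H i)) ((\<lambda>x. x i) ` K)\<close> have "(\<lambda>x. x i) ` K \<subseteq> {0..<1}"
        by (metis compactin_subset_topspace factor_topology.simps(2) topspace_circle_topology)
      then show ?thesis
        by (rule bounded_subset[rotated]) simp
    qed (auto simp: compactin_discrete_topology intro: compact_imp_bounded finite_imp_bounded)
    then obtain c where "\<forall>x\<in>K. \<bar>x i\<bar> \<le> c"
      by (auto simp: bounded_iff)
    then show ?thesis
      by (meson order_trans real_arch_simple)
  qed
  then obtain b :: "'a \<Rightarrow> nat" where b: "\<And>i x. x \<in> K \<Longrightarrow> \<bar>x i\<bar> \<le> real (b i)"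
    by metis
  have "b i \<le> sum b UNIV" for i
    by (rule member_le_sum) auto
  then have "\<bar>x i\<bar> \<le> real (Suc (sum b UNIV))" if "x \<in> K" for i x
    using b[OF that, of i] by (meson le_SucI of_nat_le_iff order_trans)
  then have "K \<subseteq> group_box H (sum b UNIV)"
    using compactin_subset_topspace[OF K] by (auto simp: group_box_def)
  then show ?thesis
    by (rule that)
qed

lemma group_box_exhausts:
  assumes "x \<in> topspace (group_topology H)"
  shows "\<forall>\<^sub>F n in sequentially. x \<in> group_box H n"
proof -
  obtain n where "\<forall>i. \<bar>x i\<bar> \<le> real n"
  proof -
    obtain n where "(\<Sum>i\<in>UNIV. \<bar>x i\<bar>) \<le> real n"
      using real_arch_simple by blast
    moreover have "\<bar>x i\<bar> \<le> (\<Sum>i\<in>UNIV. \<bar>x i\<bar>)" for i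
      by (rule member_le_sum) auto
    ultimately show ?thesis
      by (meson order_trans that)
  qed
  then have "x \<in> group_box H m" if "m \<ge> n" for m
    using assms that unfolding group_box_def mem_Collect_eq
    by (meson le_SucI of_nat_le_iff order_trans)
  then show ?thesis
    by (auto simp: eventually_sequentially)
qed

lemma L1_locD:
  "f \<in> L1_loc H \<Longrightarrow> compactin (group_topology H) K \<Longrightarrow>
    bochner_integrable (haar H) (\<lambda>x. indicat_real K x *\<^sub>R f x)"
  by (simp add: L1_loc_def)

lemma L1_loc_zero: "(\<lambda>x. 0) \<in> L1_loc H"
  by (simp add: L1_loc_def bochner_integrable_zero)

text \<open>The local statements on an exhausting sequence of boxes are glued by a pointwise limit.\<close>

lemma L1_loc_measurable_norm_diff:
  assumes "f \<in> L1_loc H" "g \<in> L1_loc H"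
  shows "(\<lambda>x. norm (f x - g x)) \<in> borel_measurable (haar H)"
proof (rule borel_measurable_LIMSEQ_metric)
  let ?\<chi> = "\<lambda>n. indicat_real (group_box H n)"
  show "(\<lambda>x. norm (?\<chi> n x *\<^sub>R f x - ?\<chi> n x *\<^sub>R g x)) \<in> borel_measurable (haar H)" for n
    by (intro haar.bochner_integrable_measurable_norm_diff L1_locD assms compactin_group_box)
  fix x assume "x \<in> space (haar H)"
  then have "\<forall>\<^sub>F n in sequentially. norm (?\<chi> n x *\<^sub>R f x - ?\<chi> n x *\<^sub>R g x) = norm (f x - g x)"
    using group_box_exhausts[of x H] by (auto simp: space_haar elim!: eventually_mono)
  then show "(\<lambda>n. norm (?\<chi> n x *\<^sub>R f x - ?\<chi> n x *\<^sub>R g x)) \<longlonglongrightarrow> norm (f x - g x)"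
    by (rule tendsto_eventually)
qed

text \<open>As \<open>p 0 0 = 0\<close>, the map \<open>p\<close> commutes with the cut-off to a compact set.\<close>

lemma L1_loc_nonexpansive:
  assumes f: "f \<in> L1_loc H" and g: "g \<in> L1_loc H" and p0: "p 0 0 = 0"
    and p: "\<And>a b a' b'. norm (p a b - p a' b') \<le> norm (a - a') + norm (b - b')"
  shows "(\<lambda>x. p (f x) (g x)) \<in> L1_loc H"
  unfolding L1_loc_def mem_Collect_eq
proof (intro allI impI)
  fix K assume K: "compactin (group_topology H) K"
  have "bochner_integrable (haar H) (\<lambda>x. p (indicat_real K x *\<^sub>R f x) (indicat_real K x *\<^sub>R g x))"
    by (rule haar.bochner_integrable_nonexpansive[where p = p, OF L1_locD[OF f K] L1_locD[OF g K] p0 p])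
  also have "(\<lambda>x. p (indicat_real K x *\<^sub>R f x) (indicat_real K x *\<^sub>R g x)) = (\<lambda>x. indicat_real K x *\<^sub>R p (f x) (g x))"
    by (auto simp: indicator_def p0)
  finally show "bochner_integrable (haar H) (\<lambda>x. indicat_real K x *\<^sub>R p (f x) (g x))" .
qed

lemma L1_loc_add: "f \<in> L1_loc H \<Longrightarrow> g \<in> L1_loc H \<Longrightarrow> (\<lambda>x. f x + g x) \<in> L1_loc H"
  by (rule L1_loc_nonexpansive[where p = "(+)"]) (auto simp: norm_diff_triangle_ineq)

lemma L1_loc_diff: "f \<in> L1_loc H \<Longrightarrow> g \<in> L1_loc H \<Longrightarrow> (\<lambda>x. f x - g x) \<in> L1_loc H"
proof (rule L1_loc_nonexpansive[where p = "(-)"])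
  show "norm (a - b - (a' - b')) \<le> norm (a - a') + norm (b - b')" for a b a' b' :: 'b
    using norm_triangle_ineq4[of "a - a'" "b - b'"] by (simp add: algebra_simps)
qed auto

lemma L1_loc_pointwise_norm: "f \<in> L1_loc H \<Longrightarrow> pointwise_norm f \<in> L1_loc H"
  unfolding pointwise_norm_def
proof (rule L1_loc_nonexpansive[where p = "\<lambda>a b. complex_of_real (norm a)" and g = f])
  show "norm (complex_of_real (norm a) - complex_of_real (norm a')) \<le> norm (a - a') + norm (b - b')"
    for a b a' b' :: 'b
    using norm_triangle_ineq3[of a a'] by (simp add: add_increasing2 flip: of_real_diff)
qed auto

text \<open>Dominated convergence gives convergence in the mean on every compact set, where Bochner
  integrability passes to the limit.\<close>

lemma L1_loc_dominated_AE_limit: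
  fixes g :: "('n::finite \<Rightarrow> real) \<Rightarrow> complex"
  assumes f: "\<And>j. f j \<in> L1_loc H" and g: "g \<in> L1_loc H"
    and lim: "AE x in haar H. (\<lambda>j. f j x) \<longlonglongrightarrow> v x"
    and dom: "\<And>j. AE x in haar H. norm (v x - f j x) \<le> norm (g x)"
  shows "v \<in> L1_loc H"
  unfolding L1_loc_def mem_Collect_eq
proof (intro allI impI)
  fix K assume K: "compactin (group_topology H) K"
  let ?\<chi> = "indicat_real K"
  have lim_K: "AE x in haar H. (\<lambda>j. ?\<chi> x *\<^sub>R f j x) \<longlonglongrightarrow> ?\<chi> x *\<^sub>R v x"
    using lim by eventually_elim (intro tendsto_intros)
  have int_g: "integrable (haar H) (\<lambda>x. ?\<chi> x *\<^sub>R g x)"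
    by (intro haar.bochner_integrable_imp_integrable L1_locD g K)
  have "(\<lambda>j. \<integral>\<^sup>+ x. ennreal (norm (?\<chi> x *\<^sub>R v x - ?\<chi> x *\<^sub>R f j x)) \<partial>haar H) \<longlonglongrightarrow> (\<integral>\<^sup>+ x. 0 \<partial>haar H)"
  proof (rule nn_integral_dominated_convergence)
    show "(\<lambda>x. ennreal (norm (?\<chi> x *\<^sub>R v x - ?\<chi> x *\<^sub>R f j x))) \<in> borel_measurable (haar H)" for j
      using haar.borel_measurable_norm_diff_AE_limit[OF L1_locD[OF f K] lim_K L1_locD[OF f[of j] K]]
      by measurable
    show "AE x in haar H. ennreal (norm (?\<chi> x *\<^sub>R v x - ?\<chi> x *\<^sub>R f j x)) \<le> ennreal (norm (?\<chi> x *\<^sub>R g x))" for j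
      using dom[of j] by eventually_elim (auto simp: indicator_def)
    show "(\<integral>\<^sup>+ x. ennreal (norm (?\<chi> x *\<^sub>R g x)) \<partial>haar H) < \<infinity>"
      using int_g by (simp add: integrable_iff_bounded)
    show "(\<lambda>x. ennreal (norm (?\<chi> x *\<^sub>R g x))) \<in> borel_measurable (haar H)"
      using int_g by measurable
    show "AE x in haar H. (\<lambda>j. ennreal (norm (?\<chi> x *\<^sub>R v x - ?\<chi> x *\<^sub>R f j x))) \<longlonglongrightarrow> 0"
      using lim_K
    proof eventually_elim
      case (elim x)
      have "(\<lambda>j. norm (?\<chi> x *\<^sub>R v x - ?\<chi> x *\<^sub>R f j x)) \<longlonglongrightarrow> norm (?\<chi> x *\<^sub>R v x - ?\<chi> x *\<^sub>R v x)"
        by (intro tendsto_intros elim)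
      from tendsto_ennrealI[OF this] show ?case by simp
    qed
  qed auto
  then show "bochner_integrable (haar H) (\<lambda>x. ?\<chi> x *\<^sub>R v x)"
    by (intro haar.bochner_integrable_L1_limit[OF L1_locD[OF f K] lim_K]) simp
qed

section \<open>Test functions are Schwartz-Bruhat functions\<close>

definition covering_map :: "('n \<Rightarrow> factor) \<Rightarrow> ('n \<Rightarrow> real) \<Rightarrow> 'n \<Rightarrow> real" where
  "covering_map H x = (\<lambda>i. if H i = Circle then frac (x i) else x i)"

lemma unroll_covering_map: "unroll H f x = f (covering_map H x)"
  by (simp add: unroll_def covering_map_def)

lemma covering_map_in_group: "x \<in> cover H \<Longrightarrow> covering_map H x \<in> topspace (group_topology H)"
  unfolding topspace_group_topology
proof
  fix i assume "x \<in> cover H"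
  then show "covering_map H x i \<in> topspace (factor_topology (H i))"
    by (cases "H i") (auto simp: covering_map_def cover_def topspace_circle_topology frac_lt_1)
qed

lemma covering_map_id:
  assumes "x \<in> topspace (group_topology H)" shows "covering_map H x = x"
proof
  fix i show "covering_map H x i = x i"
    using assms[unfolded topspace_group_topology, rule_format, of i]
    by (cases "H i") (auto simp: covering_map_def topspace_circle_topology frac_eq)
qed

lemma group_subset_cover: "topspace (group_topology H) \<subseteq> cover H"
proof
  fix x assume x: "x \<in> topspace (group_topology H)"
  have "x i \<in> \<int>" if "H i = Integers" for i
    using x[unfolded topspace_group_topology, rule_format, of i] that by simp
  then show "x \<in> cover H"
    by (simp add: cover_def)
qed

lemma continuous_map_covering_map_line:
  assumes x: "x \<in> cover H" and i: "i \<in> diff_directions H"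
  shows "continuous_map euclideanreal (group_topology H) (\<lambda>t. covering_map H (x(i := t)))"
  unfolding group_topology_def continuous_map_componentwise_UNIV
proof
  fix j
  show "continuous_map euclideanreal (factor_topology (H j)) (\<lambda>t. covering_map H (x(i := t)) j)"
  proof (cases "j = i")
    case True
    have "(\<lambda>t. covering_map H (x(i := t)) i) = (if H i = Circle then frac else id)"
      by (auto simp: covering_map_def)
    then show ?thesis
      using i continuous_map_frac_circle True by (cases "H i") (auto simp: diff_directions_def)
  next
    case False
    then have "(\<lambda>t. covering_map H (x(i := t)) j) = (\<lambda>t. covering_map H x j)"
      by (auto simp: covering_map_def)
    then show ?thesis
      using covering_map_in_group[OF x] by (simp add: topspace_group_topology)
  qed
qed

lemma zero_off_tsupport:
  "x \<in> topspace (group_topology H) \<Longrightarrow> x \<notin> tsupport (group_topology H) f \<Longrightarrow> f x = 0"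
  using closure_of_subset[of "{x \<in> topspace (group_topology H). f x \<noteq> 0}" "group_topology H"]
  by (auto simp: tsupport_def)

text \<open>Off the support the function vanishes on a neighbourhood, so the derivatives vanish there. The
  derivatives are those of the periodic lift, hence the neighbourhood has to be pulled back along
  the covering map; only one coordinate moves at a time.\<close>

lemma partials_zero_off_support:
  assumes "set is \<subseteq> diff_directions H" "x \<in> cover H" "covering_map H x \<notin> tsupport (group_topology H) f"
  shows "partials is (unroll H f) x = 0"
  using assms
proof (induction "is" arbitrary: x)
  case Nil
  then show ?case
    using covering_map_in_group[of x H] by (simp add: partials_def unroll_covering_map zero_off_tsupport)
next
  case (Cons i "is")
  let ?U = "{t \<in> topspace euclideanreal. covering_map H (x(i := t)) \<in>
      topspace (group_topology H) - tsupport (group_topology H) f}"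
  have i: "i \<in> diff_directions H"
    using Cons.prems(1) by simp
  have "openin (group_topology H) (topspace (group_topology H) - tsupport (group_topology H) f)"
    unfolding tsupport_def by (intro openin_diff openin_topspace closedin_closure_of)
  then have "open ?U"
    using openin_continuous_map_preimage[OF continuous_map_covering_map_line[OF Cons.prems(2) i]]
    by (simp only: open_openin)
  have xU: "x i \<in> ?U"
    using Cons.prems covering_map_in_group by (simp add: fun_upd_idem)
  have zero: "partials is (unroll H f) (x(i := t)) = 0" if "t \<in> ?U" for t
  proof (rule Cons.IH)
    show "x(i := t) \<in> cover H"
      using Cons.prems(2) i by (simp add: cover_def diff_directions_def)
    show "covering_map H (x(i := t)) \<notin> tsupport (group_topology H) f"
      using that by simp
  qed (use Cons.prems(1) in simp)
  have "((\<lambda>t. partials is (unroll H f) (x(i := t))) has_vector_derivative 0) (at (x i))"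
  proof (rule has_vector_derivative_transform_within_open[OF has_vector_derivative_const \<open>open ?U\<close> xU])
    show "0 = partials is (unroll H f) (x(i := t))" if "t \<in> ?U" for t
      using zero[OF that] by simp
  qed
  then show ?case
    by (simp add: partials_def partial1_def vector_derivative_at)
qed

lemma compact_cover_box: "compact {x \<in> cover H. \<forall>i. \<bar>x i\<bar> \<le> c}"
  for H :: "'n::finite \<Rightarrow> factor" and c :: real
proof -
  have "{x \<in> cover H. \<forall>i. \<bar>x i\<bar> \<le> c}
      = (\<Pi>\<^sub>E i\<in>UNIV. if H i = Integers then {t \<in> \<int>. \<bar>t\<bar> \<le> c} else {- c..c})"
    by (rule set_eqI) (auto simp: cover_def PiE_def Pi_def abs_le_iff minus_le_iff)
  moreover have "compactin (product_topology (\<lambda>i. euclidean) UNIV)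
      (\<Pi>\<^sub>E i\<in>UNIV. if H i = Integers then {t \<in> \<int>. \<bar>t\<bar> \<le> c} else {- c..c})"
    unfolding compactin_PiE using finite_abs_int_segment[of c] by (auto intro: finite_imp_compact)
  ultimately show ?thesis
    by (simp add: euclidean_product_topology)
qed

text \<open>The derivatives are continuous on the cover, and the support lifts to a subset of a compact box
  there; off the support they vanish. The circle and its cover have different topologies, so
  compactness of the support in the group is used only through the coordinate bounds it implies.\<close>

lemma test_function_weighted_derivative_bounded:
  assumes f: "f \<in> test_functions H" and is_dirs: "set is \<subseteq> diff_directions H"
  obtains B where "\<And>x. x \<in> topspace (group_topology H) \<Longrightarrow> weighted_derivative H k f (is, x) \<le> B"
proof -
  let ?S = "tsupport (group_topology H) f"
  obtain n where n: "?S \<subseteq> group_box H n"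
    using f compactin_group_bounded[of H ?S] by (auto simp: test_functions_def)
  let ?C = "{x \<in> cover H. \<forall>i. \<bar>x i\<bar> \<le> real (Suc n)}"
  have "continuous_on (cover H) (partials is (unroll H f))"
    using f is_dirs by (simp add: test_functions_def group_smooth_def smooth_along_def)
  then have "continuous_on ?C (partials is (unroll H f))"
    by (rule continuous_on_subset) auto
  then have "bounded (partials is (unroll H f) ` ?C)"
    by (intro compact_imp_bounded compact_continuous_image compact_cover_box)
  then obtain b where b: "\<And>x. x \<in> ?C \<Longrightarrow> cmod (partials is (unroll H f) x) \<le> b"
    by (auto simp: bounded_iff)
  have "weighted_derivative H k f (is, x) \<le> (1 + (\<Sum>i\<in>(UNIV :: 'a set). real (Suc n))) ^ k * max 0 b"
    if x: "x \<in> topspace (group_topology H)" for x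
  proof (cases "x \<in> ?S")
    case True
    then have x_box: "x \<in> ?C"
      using n group_subset_cover[of H] by (auto simp: group_box_def)
    have "(1 + (\<Sum>i\<in>UNIV. \<bar>x i\<bar>)) ^ k \<le> (1 + (\<Sum>i\<in>(UNIV :: 'a set). real (Suc n))) ^ k"
      using x_box by (intro power_mono add_left_mono sum_mono) (auto intro: add_nonneg_nonneg sum_nonneg)
    moreover have "cmod (partials is (unroll H f) x) \<le> max 0 b"
      using b[OF x_box] by simp
    ultimately show ?thesis
      unfolding weighted_derivative_def
      by (auto intro!: mult_mono zero_le_power add_nonneg_nonneg sum_nonneg)
  next
    case False
    then have "partials is (unroll H f) x = 0"
      using x group_subset_cover covering_map_id[OF x] by (intro partials_zero_off_support is_dirs) auto
    then show ?thesis
      by (auto simp: weighted_derivative_def intro!: mult_nonneg_nonneg zero_le_power add_nonneg_nonneg sum_nonneg)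
  qed
  then show ?thesis
    by (rule that)
qed

text \<open>The embedding of \<open>\<Xi>\<close> is known to be linear when tested on Schwartz-Bruhat functions, whereas
  distributions are compared on test functions; this inclusion is the link.\<close>

lemma test_functions_subset_schwartz: "test_functions H \<subseteq> schwartz_functions H"
proof
  fix f assume f: "f \<in> test_functions H"
  have "bdd_above (weighted_derivative H k f ` seminorm_indices H N)" for k N
  proof -
    let ?L = "{is. set is \<subseteq> diff_directions H \<and> length is \<le> N}"
    have "finite ?L"
      by (rule finite_lists_length_le) simp
    moreover have "bdd_above (\<Union>is\<in>?L. weighted_derivative H k f ` ({is} \<times> topspace (group_topology H)))"
    proof (subst bdd_above_UN[OF \<open>finite ?L\<close>], intro ballI)
      fix "is" assume "is \<in> ?L"
      then obtain B where "\<And>x. x \<in> topspace (group_topology H) \<Longrightarrow> weighted_derivative H k f (is, x) \<le> B"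
        using test_function_weighted_derivative_bounded[OF f] by blast
      then show "bdd_above (weighted_derivative H k f ` ({is} \<times> topspace (group_topology H)))"
        by (auto intro!: bdd_aboveI)
    qed
    moreover have "weighted_derivative H k f ` seminorm_indices H N
        = (\<Union>is\<in>?L. weighted_derivative H k f ` ({is} \<times> topspace (group_topology H)))"
      by (auto simp: seminorm_indices_def)
    ultimately show ?thesis by simp
  qed
  then show "f \<in> schwartz_functions H"
    using f by (simp add: schwartz_functions_def test_functions_def)
qed

lemma test_function_le_seminorm:
  assumes f: "f \<in> test_functions H" and x: "x \<in> topspace (group_topology H)"
  shows "cmod (f x) \<le> group_seminorm H 0 0 f"
proof -
  have "bdd_above (weighted_derivative H 0 f ` seminorm_indices H 0)"
    using subsetD[OF test_functions_subset_schwartz f] by (simp add: schwartz_functions_def)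
  then have "weighted_derivative H 0 f ([], x) \<le> group_seminorm H 0 0 f"
    unfolding group_seminorm_def by (rule cSUP_upper[rotated]) (simp add: seminorm_indices_def x)
  then show ?thesis
    by (simp add: weighted_derivative_def partials_def unroll_covering_map covering_map_id x)
qed

text \<open>On the group, a test function agrees with its lift, which is continuous on the closed set
  \<^term>\<open>cover H\<close>; and the product measure knows all Borel sets of the surrounding space.\<close>

lemma test_function_measurable:
  fixes H :: "'n::finite \<Rightarrow> factor"
  assumes f: "f \<in> test_functions H"
  shows "f \<in> borel_measurable (haar H)"
proof -
  have "(\<lambda>t. t) \<in> borel_measurable (factor_measure k)" for k
    by (cases k) (auto intro: measurable_restrict_space1)
  then have "(\<lambda>x. x i) \<in> borel_measurable (\<Pi>\<^sub>M i\<in>UNIV. factor_measure (H i))" for i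
    by (rule measurable_compose[OF measurable_component_singleton[OF UNIV_I]])
  then have "(\<lambda>x. x) \<in> borel_measurable (\<Pi>\<^sub>M i\<in>UNIV. factor_measure (H i))"
    by (rule measurable_coordinatewise_then_product)
  then have id: "(\<lambda>x. x) \<in> borel_measurable (haar H)"
    unfolding haar_def by (rule measurable_completion)
  have "cover H = (\<Inter>i\<in>{i. H i = Integers}. (\<lambda>x. x i) -` \<int>)"
    by (auto simp: cover_def)
  also have "closed \<dots>"
    by (intro closed_INT ballI closed_vimage continuous_on_product_coordinates closed_Ints)
  finally have "cover H \<in> sets borel"
    by simp
  moreover have "continuous_on (cover H) (unroll H f)"
    using f by (auto simp: test_functions_def group_smooth_def smooth_along_def partials_def dest: spec[of _ "[]"])
  ultimately have "(\<lambda>x. indicator (cover H) x *\<^sub>R unroll H f x) \<in> borel_measurable borel"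
    by (rule borel_measurable_continuous_on_indicator)
  from measurable_compose[OF id this]
  have "(\<lambda>x. indicator (cover H) x *\<^sub>R unroll H f x) \<in> borel_measurable (haar H)" .
  then show ?thesis
    by (rule measurable_cong[THEN iffD1, rotated])
       (use group_subset_cover[of H] in \<open>auto simp: space_haar unroll_covering_map covering_map_id\<close>)
qed

section \<open>Locally integrable functions as distributions\<close>

text \<open>The test function is bounded and lives on a compact set, on which \<open>f\<close> is integrable.\<close>

lemma integrable_L1_loc_test_function:
  assumes f: "f \<in> L1_loc H" and \<phi>: "\<phi> \<in> test_functions H"
  shows "integrable (haar H) (\<lambda>x. f x * \<phi> x)"
    and "tsupport (group_topology H) \<phi> \<subseteq> K \<Longrightarrow> compactin (group_topology H) K \<Longrightarrow>
      norm (\<integral>x. f x * \<phi> x \<partial>haar H) \<le> (\<integral>x. norm (indicat_real K x *\<^sub>R f x) \<partial>haar H) * group_seminorm H 0 0 \<phi>"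
proof -
  let ?s = "group_seminorm H 0 0 \<phi>"
  have bound: "norm (f x * \<phi> x) \<le> norm (norm (indicat_real K x *\<^sub>R f x) * ?s)"
    if "tsupport (group_topology H) \<phi> \<subseteq> K" "x \<in> space (haar H)" for x K
  proof (cases "x \<in> K")
    case True
    then show ?thesis
      using mult_left_mono[OF test_function_le_seminorm[OF \<phi>, of x], of "cmod (f x)"] that
      by (auto simp: space_haar norm_mult intro: order_trans)
  next
    case False
    then show ?thesis
      using zero_off_tsupport[of x H \<phi>] that by (auto simp: space_haar)
  qed
  have int: "integrable (haar H) (\<lambda>x. norm (indicat_real K x *\<^sub>R f x) * ?s)"
    if "compactin (group_topology H) K" for K
    by (intro Bochner_Integration.integrable_mult_left Bochner_Integration.integrable_norm
        haar.bochner_integrable_imp_integrable L1_locD[OF f] that)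
  let ?S = "tsupport (group_topology H) \<phi>"
  have S: "compactin (group_topology H) ?S"
    using \<phi> by (simp add: test_functions_def)
  have "integrable (haar H) (\<lambda>x. indicat_real ?S x *\<^sub>R f x)"
    by (intro haar.bochner_integrable_imp_integrable L1_locD[OF f] S)
  then have "(\<lambda>x. (indicat_real ?S x *\<^sub>R f x) * \<phi> x) \<in> borel_measurable (haar H)"
    using test_function_measurable[OF \<phi>] by measurable
  then have "(\<lambda>x. f x * \<phi> x) \<in> borel_measurable (haar H)"
    by (rule measurable_cong[THEN iffD1, rotated])
       (use zero_off_tsupport[of _ H \<phi>] in \<open>auto simp: space_haar indicator_def\<close>)
  then show int': "integrable (haar H) (\<lambda>x. f x * \<phi> x)"
    by (rule Bochner_Integration.integrable_bound[OF int[OF S]]) (rule AE_I2, rule bound, rule subset_refl)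
  have nonneg: "0 \<le> ?s"
  proof -
    have "(\<lambda>i. 0) \<in> topspace (group_topology H)"
      unfolding topspace_group_topology
    proof
      fix i show "0 \<in> topspace (factor_topology (H i))"
        by (cases "H i") (auto simp: topspace_circle_topology)
    qed
    from test_function_le_seminorm[OF \<phi> this] show ?thesis
      using norm_ge_zero order_trans by blast
  qed
  show "norm (\<integral>x. f x * \<phi> x \<partial>haar H) \<le> (\<integral>x. norm (indicat_real K x *\<^sub>R f x) \<partial>haar H) * ?s"
    if K: "?S \<subseteq> K" "compactin (group_topology H) K"
  proof -
    have "norm (\<integral>x. f x * \<phi> x \<partial>haar H) \<le> (\<integral>x. norm (f x * \<phi> x) \<partial>haar H)"
      by (rule integral_norm_bound)
    also have "\<dots> \<le> (\<integral>x. norm (indicat_real K x *\<^sub>R f x) * ?s \<partial>haar H)"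
      using bound[OF K(1)] nonneg by (intro integral_mono integrable_norm int' int K(2)) auto
    finally show ?thesis by simp
  qed
qed

lemma linear_functional_distribution_of:
  assumes f: "f \<in> L1_loc H"
  shows "linear_functional_on (test_functions H) (distribution_of H f)"
  unfolding linear_functional_on_def distribution_of_def
proof (intro conjI ballI allI)
  fix \<phi> \<psi> assume "\<phi> \<in> test_functions H" "\<psi> \<in> test_functions H"
  then show "(\<integral>x. f x * (\<phi> x + \<psi> x) \<partial>haar H) = (\<integral>x. f x * \<phi> x \<partial>haar H) + (\<integral>x. f x * \<psi> x \<partial>haar H)"
    using integrable_L1_loc_test_function(1)[OF f] by (simp add: distrib_left)
next
  fix c \<phi> show "(\<integral>x. f x * (c * \<phi> x) \<partial>haar H) = c * (\<integral>x. f x * \<phi> x \<partial>haar H)"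
    by (simp add: mult.left_commute[of _ c])
qed

lemma distribution_of_in_distributions:
  assumes f: "f \<in> L1_loc H"
  shows "distribution_of H f \<in> distributions H"
proof -
  have "\<exists>C N. \<forall>\<phi>\<in>test_functions H. tsupport (group_topology H) \<phi> \<subseteq> K \<longrightarrow>
      cmod (distribution_of H f \<phi>) \<le> C * group_seminorm H 0 N \<phi>"
    if "compactin (group_topology H) K" for K
    unfolding distribution_of_def using integrable_L1_loc_test_function(2)[OF f] that by blast
  then show ?thesis
    by (simp add: distributions_def linear_functional_distribution_of[OF f])
qed

lemma nonneg_distribution_of:
  assumes nonneg: "AE x in haar H. h x \<ge> 0"
  shows "nonneg_distribution H (distribution_of H (\<lambda>x. complex_of_real (h x)))"
  unfolding nonneg_distribution_def distribution_of_def
proof (intro ballI impI)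
  fix \<phi> :: "('a \<Rightarrow> real) \<Rightarrow> complex" assume \<phi>: "\<forall>x\<in>topspace (group_topology H). \<phi> x \<in> \<real>\<^sub>\<ge>\<^sub>0"
  have "(\<integral>x. complex_of_real (h x) * \<phi> x \<partial>haar H) = (\<integral>x. complex_of_real (h x * Re (\<phi> x)) \<partial>haar H)"
  proof (rule Bochner_Integration.integral_cong)
    fix x assume "x \<in> space (haar H)"
    then have "\<phi> x \<in> \<real>\<^sub>\<ge>\<^sub>0"
      using \<phi> by (simp add: space_haar)
    then show "complex_of_real (h x) * \<phi> x = complex_of_real (h x * Re (\<phi> x))"
      by (auto simp: complex_nonneg_Reals_iff complex_eq_iff)
  qed simp
  also have "\<dots> = complex_of_real (\<integral>x. h x * Re (\<phi> x) \<partial>haar H)"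
    by (rule integral_complex_of_real)
  also have "\<dots> \<in> \<real>\<^sub>\<ge>\<^sub>0"
  proof -
    have "0 \<le> (\<integral>x. h x * Re (\<phi> x) \<partial>haar H)"
    proof (rule integral_nonneg_AE)
      show "AE x in haar H. 0 \<le> h x * Re (\<phi> x)"
        using nonneg AE_space
        by eventually_elim (use \<phi> in \<open>auto simp: space_haar complex_nonneg_Reals_iff\<close>)
    qed
    then show ?thesis by simp
  qed
  finally show "(\<integral>x. complex_of_real (h x) * \<phi> x \<partial>haar H) \<in> \<real>\<^sub>\<ge>\<^sub>0" .
qed

lemma distribution_of_diff:
  assumes "f \<in> L1_loc H" "g \<in> L1_loc H" "\<phi> \<in> test_functions H"
  shows "distribution_of H (\<lambda>x. f x - g x) \<phi> = distribution_of H f \<phi> - distribution_of H g \<phi>"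
  unfolding distribution_of_def using integrable_L1_loc_test_function(1)[of _ H \<phi>] assms
  by (simp add: left_diff_distrib)

lemma distribution_of_add:
  assumes "f \<in> L1_loc H" "g \<in> L1_loc H" "\<phi> \<in> test_functions H"
  shows "distribution_of H (\<lambda>x. f x + g x) \<phi> = distribution_of H f \<phi> + distribution_of H g \<phi>"
  unfolding distribution_of_def using integrable_L1_loc_test_function(1)[of _ H \<phi>] assms
  by (simp add: distrib_right)

lemma distribution_of_cong_AE:
  assumes "f \<in> L1_loc H" "g \<in> L1_loc H" "\<phi> \<in> test_functions H" "AE x in haar H. f x = g x"
  shows "distribution_of H f \<phi> = distribution_of H g \<phi>"
  unfolding distribution_of_def using integrable_L1_loc_test_function(1)[of _ H \<phi>] assms
  by (intro integral_cong_AE) auto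

lemma nonneg_distribution_of_diff:
  assumes f: "(\<lambda>x. complex_of_real (f x)) \<in> L1_loc H" and g: "(\<lambda>x. complex_of_real (g x)) \<in> L1_loc H"
    and le: "AE x in haar H. f x \<le> g x"
  shows "nonneg_distribution H (\<lambda>\<phi>. distribution_of H (\<lambda>x. complex_of_real (g x)) \<phi>
                                  - distribution_of H (\<lambda>x. complex_of_real (f x)) \<phi>)"
proof -
  have "nonneg_distribution H (distribution_of H (\<lambda>x. complex_of_real (g x - f x)))"
    using le by (intro nonneg_distribution_of) simp
  then show ?thesis
    using distribution_of_diff[OF g f] by (simp add: nonneg_distribution_def)
qed

section \<open>Representing elements of \<open>\<Xi>\<close>\<close>

text \<open>The zero element is recovered from additivity alone, as a solution of \<open>a = a + a\<close>.\<close>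

lemma is_distribution_zero:
  assumes emb: "continuously_embedded (schwartz_functions H) D \<iota>"
  shows "is_distribution H \<iota> 0 (distribution_of H (\<lambda>x. 0))"
proof -
  have "\<iota> (0 + 0) \<phi> = \<iota> 0 \<phi> + \<iota> 0 \<phi>" if "\<phi> \<in> test_functions H" for \<phi>
    using emb test_functions_subset_schwartz that unfolding continuously_embedded_def by blast
  then show ?thesis
    by (simp add: is_distribution_def distribution_of_def)
qed

lemma is_distribution_add:
  assumes emb: "continuously_embedded (schwartz_functions H) D \<iota>"
    and "f \<in> L1_loc H" "is_distribution H \<iota> x (distribution_of H f)"
    and "g \<in> L1_loc H" "is_distribution H \<iota> y (distribution_of H g)"
  shows "is_distribution H \<iota> (x + y) (distribution_of H (\<lambda>\<xi>. f \<xi> + g \<xi>))"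
proof -
  have "\<iota> (x + y) \<phi> = \<iota> x \<phi> + \<iota> y \<phi>" if "\<phi> \<in> test_functions H" for \<phi>
    using emb test_functions_subset_schwartz that unfolding continuously_embedded_def by blast
  then show ?thesis
    using assms by (simp add: is_distribution_def distribution_of_add)
qed

lemma is_distribution_sum:
  fixes n :: nat
  assumes emb: "continuously_embedded (schwartz_functions H) D \<iota>"
    and h: "\<And>j. h j \<in> L1_loc H" "\<And>j. is_distribution H \<iota> (x j) (distribution_of H (h j))"
  shows "(\<lambda>\<xi>. \<Sum>j<n. h j \<xi>) \<in> L1_loc H"
    and "is_distribution H \<iota> (\<Sum>j<n. x j) (distribution_of H (\<lambda>\<xi>. \<Sum>j<n. h j \<xi>))"
proof -
  have "(\<lambda>\<xi>. \<Sum>j<n. h j \<xi>) \<in> L1_loc H \<and>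
      is_distribution H \<iota> (\<Sum>j<n. x j) (distribution_of H (\<lambda>\<xi>. \<Sum>j<n. h j \<xi>))"
  proof (induction n)
    case 0
    show ?case
      using is_distribution_zero[OF emb] by (simp add: L1_loc_zero)
  next
    case (Suc n)
    then have IH: "(\<lambda>\<xi>. \<Sum>j<n. h j \<xi>) \<in> L1_loc H"
      "is_distribution H \<iota> (\<Sum>j<n. x j) (distribution_of H (\<lambda>\<xi>. \<Sum>j<n. h j \<xi>))"
      by auto
    show ?case
      using L1_loc_add[OF IH(1) h(1)[of n]] is_distribution_add[OF emb IH h(1)[of n] h(2)[of n]]
      by simp
  qed
  then show "(\<lambda>\<xi>. \<Sum>j<n. h j \<xi>) \<in> L1_loc H"
    and "is_distribution H \<iota> (\<Sum>j<n. x j) (distribution_of H (\<lambda>\<xi>. \<Sum>j<n. h j \<xi>))"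
    by auto
qed

lemma is_distribution_cong_AE:
  assumes "is_distribution H \<iota> x (distribution_of H f)" "f \<in> L1_loc H" "g \<in> L1_loc H"
    and "AE \<xi> in haar H. f \<xi> = g \<xi>"
  shows "is_distribution H \<iota> x (distribution_of H g)"
  using assms distribution_of_cong_AE[OF assms(2,3) _ assms(4)] by (simp add: is_distribution_def)

lemma ext_norm_lessD:
  assumes "ext_norm H \<iota> w < ennreal e"
  obtains x where "is_distribution H \<iota> x w" "norm x < e"
  using assms that by (auto simp: ext_norm_def INF_less_iff ennreal_less_iff)

lemma continuous_into_L0D:
  assumes "continuous_into_L0 mode H \<iota>"
    and "\<And>m. f m \<in> L1_loc H" "\<And>m. is_distribution H \<iota> (x m) (distribution_of H (f m))"
    and "g \<in> L1_loc H" "is_distribution H \<iota> y (distribution_of H g)" "x \<longlonglongrightarrow> y"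
  shows "tendsto_in_measure mode (haar H) f g"
  using assms unfolding continuous_into_L0_def by blast

text \<open>Sequential continuity at \<open>0\<close> in quantitative form, for use with the double sequence of differences.\<close>

lemma continuous_into_L0_at_zero:
  assumes emb: "continuously_embedded (schwartz_functions H) D \<iota>"
    and cont: "continuous_into_L0 mode H \<iota>"
    and A: "A \<in> mode_sets mode (haar H)" and "\<epsilon> > 0" "\<delta> > 0"
  shows "\<exists>\<eta>>0. \<forall>h\<in>L1_loc H. \<forall>x. is_distribution H \<iota> x (distribution_of H h) \<longrightarrow> norm x < \<eta> \<longrightarrow>
           emeasure (haar H) {\<xi>\<in>A. norm (h \<xi>) > \<epsilon>} \<le> \<delta>"
proof (rule ccontr)
  assume neg: "\<not> ?thesis"
  define P where "P n h x \<longleftrightarrow> h \<in> L1_loc H \<and> is_distribution H \<iota> x (distribution_of H h) \<and>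
      norm x < inverse (real (Suc n)) \<and> \<not> emeasure (haar H) {\<xi>\<in>A. norm (h \<xi>) > \<epsilon>} \<le> \<delta>" for n h x
  have "\<exists>h x. P n h x" for n
  proof -
    have "inverse (real (Suc n)) > 0"
      by simp
    with neg show ?thesis
      unfolding P_def by blast
  qed
  then obtain h x where "\<And>n. P n (h n) (x n)"
    by metis
  then have h: "\<And>n. h n \<in> L1_loc H" "\<And>n. is_distribution H \<iota> (x n) (distribution_of H (h n))"
    and x: "\<And>n. norm (x n) < inverse (real (Suc n))"
    and big: "\<And>n. \<not> emeasure (haar H) {\<xi>\<in>A. norm (h n \<xi>) > \<epsilon>} \<le> \<delta>"
    by (auto simp: P_def)
  have "x \<longlonglongrightarrow> 0"
    by (rule Lim_null_comparison[OF _ LIMSEQ_inverse_real_of_nat])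
       (intro always_eventually allI less_imp_le x)
  then have "tendsto_in_measure mode (haar H) h (\<lambda>\<xi>. 0)"
    by (rule continuous_into_L0D[OF cont h L1_loc_zero is_distribution_zero[OF emb]])
  then have "(\<lambda>n. emeasure (haar H) {\<xi>\<in>A. norm (h n \<xi>) > \<epsilon>}) \<longlonglongrightarrow> 0"
    using A \<open>\<epsilon> > 0\<close> by (simp add: tendsto_in_measure_def)
  from order_tendstoD(2)[OF this \<open>\<delta> > 0\<close>] obtain n where
    "emeasure (haar H) {\<xi>\<in>A. norm (h n \<xi>) > \<epsilon>} < \<delta>"
    by (auto simp: eventually_sequentially)
  with big[of n] show False by simp
qed

text \<open>Completeness of \<open>\<Xi>\<close> and continuity into \<open>L\<^sup>0\<close> together: a series of functions that is absolutely
  convergent in \<open>\<Xi>\<close> has partial sums that converge in measure to a representative of its sum.\<close>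

lemma Xi_series_tendsto_in_measure:
  assumes emb: "continuously_embedded (schwartz_functions H) D \<iota>"
    and rep: "\<forall>x. \<exists>f\<in>L1_loc H. is_distribution H \<iota> x (distribution_of H f)"
    and cont: "continuous_into_L0 mode H \<iota>"
    and h: "\<And>j. h j \<in> L1_loc H" "\<And>j. is_distribution H \<iota> (x j) (distribution_of H (h j))"
    and summable: "summable (\<lambda>j. norm (x j))"
  obtains X g where "g \<in> L1_loc H" "is_distribution H \<iota> X (distribution_of H g)"
    "tendsto_in_measure mode (haar H) (\<lambda>n \<xi>. \<Sum>j<n. h j \<xi>) g"
proof -
  obtain g where g: "g \<in> L1_loc H" "is_distribution H \<iota> (suminf x) (distribution_of H g)"
    using rep by blast
  have "(\<lambda>n. \<Sum>j<n. x j) \<longlonglongrightarrow> suminf x"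
    using summable_LIMSEQ[OF summable_norm_cancel[OF summable]] .
  then have "tendsto_in_measure mode (haar H) (\<lambda>n \<xi>. \<Sum>j<n. h j \<xi>) g"
    by (rule continuous_into_L0D[OF cont is_distribution_sum[OF emb h] g])
  with g show ?thesis by (rule that)
qed

text \<open>The infimum over an empty set is \<open>\<infinity>\<close>, so an upper bound for an extended norm is also a
  statement about membership: a nonnegative function that is dominated by one in \<open>\<Xi>\<close>
  belongs to \<open>\<Xi>\<close>.\<close>

lemma representable_if_dominated:
  assumes f: "(\<lambda>\<xi>. complex_of_real (f \<xi>)) \<in> L1_loc H" and g: "(\<lambda>\<xi>. complex_of_real (g \<xi>)) \<in> L1_loc H"
    and nonneg: "AE \<xi> in haar H. 0 \<le> f \<xi>" and le: "AE \<xi> in haar H. f \<xi> \<le> g \<xi>"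
    and y: "is_distribution H \<iota> y (distribution_of H (\<lambda>\<xi>. complex_of_real (g \<xi>)))"
    and mono: "\<forall>u\<^sub>1\<in>distributions H. \<forall>u\<^sub>2\<in>distributions H.
           nonneg_distribution H u\<^sub>1 \<and> nonneg_distribution H (\<lambda>\<phi>. u\<^sub>2 \<phi> - u\<^sub>1 \<phi>) \<longrightarrow>
           ext_norm H \<iota> u\<^sub>1 \<le> ennreal K * ext_norm H \<iota> u\<^sub>2"
  obtains x where "is_distribution H \<iota> x (distribution_of H (\<lambda>\<xi>. complex_of_real (f \<xi>)))"
proof -
  let ?f = "distribution_of H (\<lambda>\<xi>. complex_of_real (f \<xi>))"
    and ?g = "distribution_of H (\<lambda>\<xi>. complex_of_real (g \<xi>))"
  have "ext_norm H \<iota> ?f \<le> ennreal K * ext_norm H \<iota> ?g"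
    using mono distribution_of_in_distributions[OF f] distribution_of_in_distributions[OF g]
      nonneg_distribution_of[OF nonneg] nonneg_distribution_of_diff[OF f g le] by blast
  also have "\<dots> \<le> ennreal K * ennreal (norm y)"
    using y by (intro mult_left_mono) (auto simp: ext_norm_def intro: INF_lower)
  also have "\<dots> < \<infinity>"
    by (simp add: ennreal_mult_less_top)
  finally have finite: "ext_norm H \<iota> ?f < \<infinity>" .
  have "{x. is_distribution H \<iota> x ?f} \<noteq> {}"
  proof
    assume "{x. is_distribution H \<iota> x ?f} = {}"
    with finite show False
      unfolding ext_norm_def by (simp only: image_empty Inf_empty infinity_ennreal_def)
  qed
  then show ?thesis
    using that by blast
qed

text \<open>A sequence of finite total variation converges, and its distance to the limit is at most the
  total variation. The variation is a complex limit here because elements of \<open>\<Xi>\<close> are represented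
  by complex functions.\<close>

lemma LIMSEQ_of_bounded_variation:
  fixes w :: "nat \<Rightarrow> 'b::banach" and g :: complex
  assumes "(\<lambda>n. complex_of_real (\<Sum>j<n. norm (w (Suc j) - w j))) \<longlonglongrightarrow> g"
  shows "w \<longlonglongrightarrow> lim w" and "norm (lim w - w n) \<le> norm g"
proof -
  let ?a = "\<lambda>j. norm (w (Suc j) - w j)"
  have "(\<lambda>n. norm (complex_of_real (\<Sum>j<n. ?a j))) \<longlonglongrightarrow> norm g"
    by (intro tendsto_norm assms)
  then have "?a sums norm g"
    by (simp only: sums_def norm_of_real abs_of_nonneg[OF sum_nonneg[OF norm_ge_zero]])
  then have a: "summable ?a" "suminf ?a = norm g"
    by (auto simp: sums_iff)
  have "(\<lambda>n. \<Sum>j<n. w (Suc j) - w j) \<longlonglongrightarrow> (\<Sum>j. w (Suc j) - w j)"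
    using summable_LIMSEQ[OF summable_norm_cancel[OF a(1)]] .
  then have "(\<lambda>n. (\<Sum>j<n. w (Suc j) - w j) + w 0) \<longlonglongrightarrow> (\<Sum>j. w (Suc j) - w j) + w 0"
    by (intro tendsto_intros)
  then have "w \<longlonglongrightarrow> (\<Sum>j. w (Suc j) - w j) + w 0"
    by (simp add: sum_lessThan_telescope)
  then show lim: "w \<longlonglongrightarrow> lim w"
    by (rule convergent_LIMSEQ_iff[THEN iffD1, OF convergentI])
  have "norm (w k - w n) \<le> norm g" if "k \<ge> n" for k
  proof -
    have "w k - w n = (\<Sum>j=n..<k. w (Suc j) - w j)"
      using that by (simp add: sum_Suc_diff')
    then have "norm (w k - w n) \<le> (\<Sum>j=n..<k. ?a j)"
      by (simp only: norm_sum)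
    also have "\<dots> \<le> suminf ?a"
      by (rule sum_le_suminf[OF a(1)]) auto
    finally show ?thesis
      by (simp only: a(2))
  qed
  then show "norm (lim w - w n) \<le> norm g"
    by (intro tendsto_upperbound[OF tendsto_norm[OF tendsto_diff[OF lim tendsto_const]]])
       (auto simp: eventually_sequentially)
qed

lemma strict_mono_subseq_Cauchy:
  assumes "\<And>j. \<exists>N. \<forall>m\<ge>N. \<forall>k\<ge>N. P j m k"
  obtains r :: "nat \<Rightarrow> nat" where "strict_mono r" "\<And>j. P j (r (Suc j)) (r j)"
proof -
  obtain N :: "nat \<Rightarrow> nat" where N: "\<And>j m k. m \<ge> N j \<Longrightarrow> k \<ge> N j \<Longrightarrow> P j m k"
    using assms by metis
  \<comment> \<open>Partial sums are strictly increasing and dominate every single \<open>N i\<close>.\<close>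
  define r where "r n = (\<Sum>i\<le>n. Suc (N i))" for n
  have r: "strict_mono r"
    by (simp add: strict_mono_Suc_iff r_def)
  have "N j \<le> r j" for j
    using member_le_sum[of j "{..j}" "\<lambda>i. Suc (N i)"] by (simp add: r_def)
  moreover have "r j \<le> r (Suc j)" for j
    by (simp add: r_def)
  ultimately have "P j (r (Suc j)) (r j)" for j
    by (meson N order_trans)
  with r show ?thesis by (rule that)
qed

text \<open>Here \<open>H\<close> plays the part of the dual group.\<close>

lemma vector_Xi_Cauchy_tendsto_in_measure:
  fixes H :: "'n::finite \<Rightarrow> factor" and u :: "nat \<Rightarrow> ('n \<Rightarrow> real) \<Rightarrow> 'y::banach"
    and \<iota> :: "'x::complex_banach \<Rightarrow> (('n \<Rightarrow> real) \<Rightarrow> complex) \<Rightarrow> complex"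
  assumes emb: "continuously_embedded (schwartz_functions H) D \<iota>"
    and rep: "\<forall>x. \<exists>f\<in>L1_loc H. is_distribution H \<iota> x (distribution_of H f)"
    and mono: "\<forall>u\<^sub>1\<in>distributions H. \<forall>u\<^sub>2\<in>distributions H.
           nonneg_distribution H u\<^sub>1 \<and> nonneg_distribution H (\<lambda>\<phi>. u\<^sub>2 \<phi> - u\<^sub>1 \<phi>) \<longrightarrow>
           ext_norm H \<iota> u\<^sub>1 \<le> ennreal K * ext_norm H \<iota> u\<^sub>2"
    and cont: "continuous_into_L0 mode H \<iota>"
    and u: "\<forall>m. u m \<in> vector_Xi H \<iota>"
    and Cauchy: "\<forall>\<epsilon>>0. \<exists>N. \<forall>m\<ge>N. \<forall>k\<ge>N. vector_norm H \<iota> (\<lambda>\<xi>. u m \<xi> - u k \<xi>) < ennreal \<epsilon>"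
  shows "\<exists>v\<in>vector_Xi H \<iota>. tendsto_in_measure mode (haar H) u v"
proof -
  have u_L1: "u m \<in> L1_loc H" for m
    using u by (simp add: vector_Xi_def)
  have norm_diff_L1: "pointwise_norm (\<lambda>\<xi>. u m \<xi> - u k \<xi>) \<in> L1_loc H" for m k
    by (intro L1_loc_pointwise_norm L1_loc_diff u_L1)

  \<comment> \<open>A rapidly converging subsequence and its limit almost everywhere.\<close>
  have "\<exists>N. \<forall>m\<ge>N. \<forall>k\<ge>N. vector_norm H \<iota> (\<lambda>\<xi>. u m \<xi> - u k \<xi>) < ennreal ((1/2)^j)" for j
    using Cauchy by simp
  then obtain r where r: "strict_mono r"
    and fast: "\<And>j. vector_norm H \<iota> (\<lambda>\<xi>. u (r (Suc j)) \<xi> - u (r j) \<xi>) < ennreal ((1/2)^j)"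
    using strict_mono_subseq_Cauchy[where P = "\<lambda>j m k. vector_norm H \<iota> (\<lambda>\<xi>. u m \<xi> - u k \<xi>) < ennreal ((1/2)^j)"]
    by blast
  define w where "w j = u (r j)" for j
  have w_L1: "w j \<in> L1_loc H" for j
    by (simp add: w_def u_L1)

  define d where "d j = pointwise_norm (\<lambda>\<xi>. w (Suc j) \<xi> - w j \<xi>)" for j
  have d_L1: "d j \<in> L1_loc H" for j
    by (simp add: d_def w_def norm_diff_L1)
  have "\<exists>x. is_distribution H \<iota> x (distribution_of H (d j)) \<and> norm x < (1/2)^j" for j
    using fast[of j] unfolding vector_norm_def d_def w_def by (blast elim: ext_norm_lessD)
  then obtain x where x: "\<And>j. is_distribution H \<iota> (x j) (distribution_of H (d j))"
    and norm_x: "\<And>j. norm (x j) < (1/2)^j"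
    by metis
  have "summable (\<lambda>j. norm (x j))"
    by (rule summable_comparison_test'[where g = "\<lambda>j. (1/2::real)^j" and N = 0])
       (auto intro: less_imp_le norm_x simp: summable_geometric)
  from Xi_series_tendsto_in_measure[OF emb rep cont d_L1 x this] obtain X g where
    g: "g \<in> L1_loc H" and X: "is_distribution H \<iota> X (distribution_of H g)" and d_sum: "tendsto_in_measure mode (haar H) (\<lambda>n \<xi>. \<Sum>j<n. d j \<xi>) g"
    by metis
  have d_eq: "(\<Sum>j<n. d j \<xi>) = complex_of_real (\<Sum>j<n. norm (w (Suc j) \<xi> - w j \<xi>))" for n \<xi>
    by (simp add: d_def pointwise_norm_def)
  have d_lim: "AE \<xi> in haar H. (\<lambda>n. complex_of_real (\<Sum>j<n. norm (w (Suc j) \<xi> - w j \<xi>))) \<longlonglongrightarrow> g \<xi>"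
  proof (rule tendsto_in_measure_incseq_AE[OF sigma_finite_haar])
    show "tendsto_in_measure mode (haar H) (\<lambda>n \<xi>. complex_of_real (\<Sum>j<n. norm (w (Suc j) \<xi> - w j \<xi>))) g"
      using d_sum by (simp only: d_eq)
    show "(\<lambda>\<xi>. norm (complex_of_real (\<Sum>j<n. norm (w (Suc j) \<xi> - w j \<xi>)) - g \<xi>)) \<in> borel_measurable (haar H)" for n
      using L1_loc_measurable_norm_diff[OF is_distribution_sum(1)[where h = d and x = x and n = n, OF emb d_L1 x] g] by (simp only: d_eq)
    show "incseq (\<lambda>n. \<Sum>j<n. norm (w (Suc j) \<xi> - w j \<xi>))" for \<xi>
      by (rule incseq_SucI) simp
  qed
  then have AE_lim: "AE \<xi> in haar H. (\<lambda>j. w j \<xi>) \<longlonglongrightarrow> lim (\<lambda>j. w j \<xi>)"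
    and AE_dom: "AE \<xi> in haar H. norm (lim (\<lambda>j. w j \<xi>) - w n \<xi>) \<le> norm (g \<xi>)" for n
    by (auto elim!: eventually_mono intro: LIMSEQ_of_bounded_variation)
  \<comment> \<open>Where the limit does not exist, which is on a null set only, the value is arbitrary.\<close>
  define v where "v \<xi> = lim (\<lambda>j. w j \<xi>)" for \<xi>
  have v_L1: "v \<in> L1_loc H"
    using AE_lim AE_dom unfolding v_def[symmetric] by (rule L1_loc_dominated_AE_limit[OF w_L1 g])

  \<comment> \<open>The norm of the limit belongs to \<open>\<Xi>\<close>, being dominated by a function that does.\<close>
  have v_le: "AE \<xi> in haar H. norm (v \<xi>) \<le> norm (w 0 \<xi>) + norm (g \<xi>)"
    using AE_dom[of 0]
  proof eventually_elim
    case (elim \<xi>)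
    then show ?case
      using norm_triangle_sub[of "v \<xi>" "w 0 \<xi>"] by (simp add: v_def)
  qed
  have g_nonneg: "AE \<xi> in haar H. g \<xi> = pointwise_norm g \<xi>"
    using d_lim
  proof eventually_elim
    case (elim \<xi>)
    have "(\<lambda>n. complex_of_real (norm (complex_of_real (\<Sum>j<n. norm (w (Suc j) \<xi> - w j \<xi>))))) \<longlonglongrightarrow> pointwise_norm g \<xi>"
      unfolding pointwise_norm_def by (intro tendsto_intros elim)
    then have "(\<lambda>n. complex_of_real (\<Sum>j<n. norm (w (Suc j) \<xi> - w j \<xi>))) \<longlonglongrightarrow> pointwise_norm g \<xi>"
      by (simp only: norm_of_real abs_of_nonneg[OF sum_nonneg[OF norm_ge_zero]])
    with elim show ?case
      by (rule LIMSEQ_unique)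
  qed
  have X_norm: "is_distribution H \<iota> X (distribution_of H (pointwise_norm g))"
    by (rule is_distribution_cong_AE[OF X g L1_loc_pointwise_norm[OF g] g_nonneg])
  obtain y where y: "is_distribution H \<iota> y (distribution_of H (pointwise_norm (w 0)))"
    using u by (auto simp: vector_Xi_def w_def)
  note norms_L1 = L1_loc_pointwise_norm[OF w_L1[of 0]] L1_loc_pointwise_norm[OF g]
  have bound_eq: "(\<lambda>\<xi>. pointwise_norm (w 0) \<xi> + pointwise_norm g \<xi>)
      = (\<lambda>\<xi>. complex_of_real (norm (w 0 \<xi>) + norm (g \<xi>)))"
    by (simp add: pointwise_norm_def)
  obtain z where "is_distribution H \<iota> z (distribution_of H (\<lambda>\<xi>. complex_of_real (norm (v \<xi>))))"
  proof (rule representable_if_dominated[OF _ _ _ v_le _ mono])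
    show "(\<lambda>\<xi>. complex_of_real (norm (v \<xi>))) \<in> L1_loc H"
      using L1_loc_pointwise_norm[OF v_L1] unfolding pointwise_norm_def[abs_def] .
    show "(\<lambda>\<xi>. complex_of_real (norm (w 0 \<xi>) + norm (g \<xi>))) \<in> L1_loc H"
      using L1_loc_add[OF norms_L1] unfolding bound_eq .
    show "is_distribution H \<iota> (y + X) (distribution_of H (\<lambda>\<xi>. complex_of_real (norm (w 0 \<xi>) + norm (g \<xi>))))"
      using is_distribution_add[OF emb norms_L1(1) y norms_L1(2) X_norm] unfolding bound_eq .
  qed simp_all
  then have "v \<in> vector_Xi H \<iota>"
    using v_L1 by (auto simp: vector_Xi_def pointwise_norm_def[abs_def])
  \<comment> \<open>The whole sequence converges: differences of small norm are small in measure.\<close>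
  moreover have "tendsto_in_measure mode (haar H) u v"
  proof (rule tendsto_in_measure_if_Cauchy_and_AE_subseq)
    fix A and \<epsilon> :: real and \<delta> :: ennreal
    assume *: "A \<in> mode_sets mode (haar H)" "\<epsilon> > 0" "\<delta> > 0"
    obtain \<eta> where \<eta>: "\<eta> > 0" "\<And>h x. h \<in> L1_loc H \<Longrightarrow> is_distribution H \<iota> x (distribution_of H h) \<Longrightarrow>
        norm x < \<eta> \<Longrightarrow> emeasure (haar H) {\<xi>\<in>A. norm (h \<xi>) > \<epsilon>} \<le> \<delta>"
      using continuous_into_L0_at_zero[OF emb cont *] by blast
    obtain N where N: "\<And>m k. m \<ge> N \<Longrightarrow> k \<ge> N \<Longrightarrow> vector_norm H \<iota> (\<lambda>\<xi>. u m \<xi> - u k \<xi>) < ennreal \<eta>"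
      using Cauchy \<eta>(1) by blast
    have "emeasure (haar H) {\<xi>\<in>A. norm (u m \<xi> - u k \<xi>) > \<epsilon>} \<le> \<delta>" if mk: "m \<ge> N" "k \<ge> N" for m k
    proof -
      obtain x where "is_distribution H \<iota> x (distribution_of H (pointwise_norm (\<lambda>\<xi>. u m \<xi> - u k \<xi>)))" "norm x < \<eta>"
        using N[OF mk] unfolding vector_norm_def by (rule ext_norm_lessD)
      from \<eta>(2)[OF norm_diff_L1 this] show ?thesis
        by (simp add: pointwise_norm_def)
    qed
    then show "\<exists>N. \<forall>m\<ge>N. \<forall>k\<ge>N. emeasure (haar H) {\<xi>\<in>A. norm (u m \<xi> - u k \<xi>) > \<epsilon>} \<le> \<delta>"
      by blast
  next
    show "AE \<xi> in haar H. (\<lambda>j. u (r j) \<xi>) \<longlonglongrightarrow> v \<xi>"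
      using AE_lim by (simp add: v_def w_def)
  qed (intro r L1_loc_measurable_norm_diff u_L1 v_L1)+
  ultimately show ?thesis by blast
qed

theorem proposition3:
  fixes G :: "'n::finite \<Rightarrow> factor"
    and Y :: "'m topology" and d :: nat and \<A> :: "('m set \<times> ('m \<Rightarrow> nat \<Rightarrow> real)) set"
    and \<iota>\<^sub>Y :: "'y::complex_banach \<Rightarrow> ('m \<Rightarrow> complex) \<Rightarrow> complex"
    and \<iota>\<^sub>\<Xi> :: "'x::complex_banach \<Rightarrow> (('n \<Rightarrow> real) \<Rightarrow> complex) \<Rightarrow> complex"
    and mode :: measure_mode
    and K\<^sub>\<Xi> c\<^sub>\<Xi> :: real
    and u :: "nat \<Rightarrow> ('n \<Rightarrow> real) \<Rightarrow> 'y"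
  assumes manifold: "smooth_manifold Y d \<A>" and connected: "connected_space Y"
    and embedded_Y: "continuously_embedded (mfd_test_functions Y d \<A>) (mfd_distributions Y d \<A>) \<iota>\<^sub>Y"
    and embedded_Xi: "continuously_embedded (schwartz_functions (dual_group G)) (tempered_distributions (dual_group G)) \<iota>\<^sub>\<Xi>"
    and Xi_L1_loc: "\<forall>x. \<exists>f\<in>L1_loc (dual_group G). is_distribution (dual_group G) \<iota>\<^sub>\<Xi> x (distribution_of (dual_group G) f)"
    and K_pos: "K\<^sub>\<Xi> > 0"
    and i: "\<forall>u\<^sub>1\<in>distributions (dual_group G). \<forall>u\<^sub>2\<in>distributions (dual_group G).
           nonneg_distribution (dual_group G) u\<^sub>1 \<and> nonneg_distribution (dual_group G) (\<lambda>\<phi>. u\<^sub>2 \<phi> - u\<^sub>1 \<phi>) \<longrightarrow>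
           ext_norm (dual_group G) \<iota>\<^sub>\<Xi> u\<^sub>1 \<le> ennreal K\<^sub>\<Xi> * ext_norm (dual_group G) \<iota>\<^sub>\<Xi> u\<^sub>2"
    and ii: "continuous_into_L0 mode (dual_group G) \<iota>\<^sub>\<Xi>"
    and c_pos: "c\<^sub>\<Xi> > 0"
    and iii: "\<forall>f\<in>L1_loc (dual_group G).
           ext_norm (dual_group G) \<iota>\<^sub>\<Xi> (distribution_of (dual_group G) f)
             \<le> ennreal c\<^sub>\<Xi> * ext_norm (dual_group G) \<iota>\<^sub>\<Xi> (distribution_of (dual_group G) (pointwise_norm f))"
    and u_Xi: "\<forall>m. u m \<in> vector_Xi (dual_group G) \<iota>\<^sub>\<Xi>"
    and u_Cauchy: "\<forall>\<epsilon>>0. \<exists>N. \<forall>m\<ge>N. \<forall>k\<ge>N.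
           vector_norm (dual_group G) \<iota>\<^sub>\<Xi> (\<lambda>\<xi>. u m \<xi> - u k \<xi>) < ennreal \<epsilon>"
  shows "\<exists>v\<in>vector_Xi (dual_group G) \<iota>\<^sub>\<Xi>. tendsto_in_measure mode (haar (dual_group G)) u v"
  by (rule vector_Xi_Cauchy_tendsto_in_measure
      [OF embedded_Xi Xi_L1_loc i ii u_Xi u_Cauchy])

end
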